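(* Let $\Omega$ be a $\sigma$-compact metric space, $\nu$ a probability measure on the Borel $\sigma$-field of $\Omega$, $\mathcal{C}\in\mathbb{R}^{m\times m\times p}$ a TPSD T-product tensor, and $\tau\mapsto\mathcal{D}_\tau\in\mathbb{R}^{m\times m\times p}$ a continuous map from $\Omega$ into TPSD T-product tensors with $\sup_{\tau\in\Omega}\|\mathcal{D}_\tau\|<\infty$ and $\int_\Omega\|\mathcal{D}_\tau^{-q}\|_1\,d\nu(\tau)<\infty$ for every $q>0$. Then the following three statements are equivalent: (i) $\vec{\lambda}(\mathcal{C})\prec_{\log}\exp\int_{\Omega}\log\vec{\lambda}(\mathcal{D}_\tau)\,d\nu(\tau)$; (ii) for every continuous $f:(0,\infty)\to[0,\infty)$ such that $x\mapsto\log f(e^x)$ is convex on $\mathbb{R}$ and every unitarily invariant norm $\|\cdot\|_\rho$, $$\|f(\mathcal{C})\|_\rho\le\exp\int_\Omega\log\|f(\mathcal{D}_\tau)\|_\rho\,d\nu(\tau);$$ (iii) for every continuous $g:(0,\infty)\to[0,\infty)$ such that $x\mapsto g(e^x)$ is convex on $\mathbb{R}$ and every unitarily invariant norm $\|\cdot\|_\rho$, $$\|g(\mathcal{C})\|_\rho\le\int_\Omega\|g(\mathcal{D}_\tau)\|_\rho\,d\nu(\tau).$$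
   Context: T-product basics: for $\mathcal{C}\in\mathbb{C}^{m\times n\times p}$ with frontal slices $C^{(1)},\dots,C^{(p)}$, $\mathrm{bcirc}(\mathcal{C})$ is the $mp\times np$ block-circulant matrix with $(i,j)$ block $C^{(((i-j)\bmod p)+1)}$, $\mathrm{unfold}(\mathcal{C})$ stacks the slices vertically, $\mathrm{fold}=\mathrm{unfold}^{-1}$, and $\mathcal{C}\star\mathcal{D}=\mathrm{fold}(\mathrm{bcirc}(\mathcal{C})\mathrm{unfold}(\mathcal{D}))$. $\mathcal{C}^H=\mathrm{bcirc}^{-1}(\mathrm{bcirc}(\mathcal{C})^H)$, $\mathcal{C}^T=\mathrm{bcirc}^{-1}(\mathrm{bcirc}(\mathcal{C})^T)$; a real square tensor is symmetric if $\mathcal{C}^T=\mathcal{C}$. Every square $\mathcal{C}$ satisfies $\mathrm{bcirc}(\mathcal{C})=(F_p^H\otimes I_m)\mathrm{Diag}(C_1,\dots,C_p)(F_p\otimes I_m)$ with $F_p$ the normalized $p\times p$ DFT matrix; $C_1,\dots,C_p$ are the Fourier blocks (Hermitian if $\mathcal{C}$ is symmetric). The T-eigenvalues of a symmetric $\mathcal{C}$ are the $mp$ eigenvalues (with multiplicity) of $C_1,\dots,C_p$, listed as $\lambda_1(\mathcal{C})\ge\dots\ge\lambda_{mp}(\mathcal{C})$, and $\vec\lambda(\mathcal{C})$ is this vector; a symmetric tensor is TPSD (resp. TPD) if all its T-eigenvalues are $\ge 0$ (resp. $>0$). The T-singular values $\sigma_1(\mathcal{C})\ge\dots\ge\sigma_{mp}(\mathcal{C})$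 are the singular values of $C_1,\dots,C_p$ together. For a function $f$ on the T-eigenvalues, $f(\mathcal{C})$ is the tensor with $\mathrm{bcirc}(f(\mathcal{C}))=(F_p^H\otimes I_m)\mathrm{Diag}(f(C_1),\dots,f(C_p))(F_p\otimes I_m)$; for $f$ defined on $(0,\infty)$ one sets $f(0):=\lim_{x\downarrow 0}f(x)\in[0,\infty]$, and $\|f(\mathcal{C})\|_\rho:=\infty$ if this limit is $\infty$ and $\mathcal{C}$ has a zero T-eigenvalue; $\mathcal{D}_\tau^{-q}$ is defined when $\mathcal{D}_\tau$ is TPD and its norm is $+\infty$ otherwise. $|\mathcal{H}|=(\mathcal{H}^H\star\mathcal{H})^{1/2}$. Unitarily invariant norms: for a symmetric gauge function $\rho$ on $\mathbb{R}^{mp}_{\ge 0}$ (restriction of a permutation-invariant absolute norm), $\|\mathcal{H}\|_\rho=\rho(\sigma_1(\mathcal{H}),\dots,\sigma_{mp}(\mathcal{H}))$; $\|\cdot\|_1=\sum_{i=1}^{mp}\sigma_i(\cdot)$ is the trace norm and $\|\cdot\|$ the operator norm. For $x,y\in[0,\infty)^r$ with decreasing rearrangements $x^\downarrow,y^\downarrow$, $x\prec_{\log}y$ means $\prod_{i=1}^k x^\downarrow_i\le\prod_{i=1}^k y^\downarrow_i$ for $k=1,\dots,r$ with equality for $k=r$. The vector $\exp\int_\Omega\log\vec\lambda(\mathcal{D}_\tau)d\nu(\tau)$ has $i$-th entry $\exp\int_\Omega\log\lambda_i(\mathcal{D}_\tau)d\nu(\tau)$, with conventions $\log 0=-\infty$,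 $e^{-\infty}=0$. *)

theory Defs
  imports "HOL-Probability.Probability" "Jordan_Normal_Form.Schur_Decomposition"
begin

text \<open>A tensor of size m x n x p is a function k \<mapsto> C k (k < p) giving its
  frontal slices C^(k+1) as m x n matrices (0-based slice index).\<close>

definition tensor_dims :: "nat \<Rightarrow> nat \<Rightarrow> nat \<Rightarrow> (nat \<Rightarrow> 'a mat) \<Rightarrow> bool" where
  "tensor_dims m n p C \<longleftrightarrow> (\<forall>k<p. C k \<in> carrier_mat m n)"

definition cplx_tensor :: "(nat \<Rightarrow> real mat) \<Rightarrow> (nat \<Rightarrow> complex mat)" where
  "cplx_tensor C = (\<lambda>k. map_mat complex_of_real (C k))"

text \<open>bcirc: the (mp) x (np) block circulant matrix, block (I,J) = C^(((I-J) mod p)+1).\<close>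
definition bcirc :: "nat \<Rightarrow> nat \<Rightarrow> nat \<Rightarrow> (nat \<Rightarrow> 'a mat) \<Rightarrow> 'a mat" where
  "bcirc m n p C = mat (m*p) (n*p)
     (\<lambda>(i,j). C ((i div m + p - j div n) mod p) $$ (i mod m, j mod n))"

definition dft_mat :: "nat \<Rightarrow> complex mat" where
  "dft_mat p = mat p p (\<lambda>(a,b). cis (- 2 * pi * real (a*b) / real p) / complex_of_real (sqrt (real p)))"

definition kron_id :: "complex mat \<Rightarrow> nat \<Rightarrow> complex mat" where
  "kron_id F m = mat (dim_row F * m) (dim_col F * m)
     (\<lambda>(i,j). if i mod m = j mod m then F $$ (i div m, j div m) else 0)"

definition blkdiag :: "nat \<Rightarrow> nat \<Rightarrow> (nat \<Rightarrow> complex mat) \<Rightarrow> complex mat" where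
  "blkdiag m p B = mat (m*p) (m*p)
     (\<lambda>(i,j). if i div m = j div m then B (i div m) $$ (i mod m, j mod m) else 0)"

definition blk :: "nat \<Rightarrow> nat \<Rightarrow> 'a mat \<Rightarrow> nat \<Rightarrow> nat \<Rightarrow> 'a mat" where
  "blk m n M I J = mat m n (\<lambda>(i,j). M $$ (I*m+i, J*n+j))"

text \<open>Fourier blocks C_1..C_p (0-based: a < p) of a square tensor: the diagonal blocks of
  (F_p \<otimes> I_m) bcirc(C) (F_p^H \<otimes> I_m), which is block diagonal.\<close>
definition fblock :: "nat \<Rightarrow> nat \<Rightarrow> (nat \<Rightarrow> complex mat) \<Rightarrow> nat \<Rightarrow> complex mat" where
  "fblock m p C a = blk m m (kron_id (dft_mat p) m * bcirc m m p C * kron_id (mat_adjoint (dft_mat p)) m) a a"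

definition eigs :: "complex mat \<Rightarrow> complex multiset" where
  "eigs A = proots (char_poly A)"

text \<open>T-eigenvalues (multiset of real numbers; Fourier blocks are Hermitian for symmetric tensors).\<close>
definition teigs :: "nat \<Rightarrow> nat \<Rightarrow> (nat \<Rightarrow> complex mat) \<Rightarrow> real multiset" where
  "teigs m p C = (\<Sum>a<p. image_mset Re (eigs (fblock m p C a)))"

definition teig_list :: "nat \<Rightarrow> nat \<Rightarrow> (nat \<Rightarrow> real mat) \<Rightarrow> real list" where
  "teig_list m p C = rev (sorted_list_of_multiset (teigs m p (cplx_tensor C)))"

definition svals :: "complex mat \<Rightarrow> real multiset" where
  "svals A = image_mset (\<lambda>z. sqrt (Re z)) (eigs (mat_adjoint A * A))"

definition tsval_list :: "nat \<Rightarrow> nat \<Rightarrow> (nat \<Rightarrow> complex mat) \<Rightarrow> real list" where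
  "tsval_list m p H = rev (sorted_list_of_multiset (\<Sum>a<p. svals (fblock m p H a)))"

text \<open>Real symmetric tensor: C^T = C, i.e. bcirc(C)^T = bcirc(C); TPSD: symmetric with
  all T-eigenvalues nonnegative.\<close>
definition tsym :: "nat \<Rightarrow> nat \<Rightarrow> (nat \<Rightarrow> real mat) \<Rightarrow> bool" where
  "tsym m p C \<longleftrightarrow> tensor_dims m m p C \<and> transpose_mat (bcirc m m p C) = bcirc m m p C"

definition tpsd :: "nat \<Rightarrow> nat \<Rightarrow> (nat \<Rightarrow> real mat) \<Rightarrow> bool" where
  "tpsd m p C \<longleftrightarrow> tsym m p C \<and> (\<forall>x \<in> set (teig_list m p C). 0 \<le> x)"

definition unitary_mat :: "nat \<Rightarrow> complex mat \<Rightarrow> bool" where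
  "unitary_mat n U \<longleftrightarrow> U \<in> carrier_mat n n \<and> mat_adjoint U * U = 1\<^sub>m n"

definition herm_fun :: "(real \<Rightarrow> real) \<Rightarrow> complex mat \<Rightarrow> complex mat" where
  "herm_fun h A = (let n = dim_row A in
     SOME B. \<exists>U d. unitary_mat n U \<and>
        A = U * mat_diag n (\<lambda>i. complex_of_real (d i)) * mat_adjoint U \<and>
        B = U * mat_diag n (\<lambda>i. complex_of_real (h (d i))) * mat_adjoint U)"

text \<open>h(C): the tensor with bcirc(h(C)) = (F_p^H \<otimes> I) Diag(h(C_1),...,h(C_p)) (F_p \<otimes> I),
  recovered (bcirc^{-1}) as the first block column.\<close>
definition tfun :: "nat \<Rightarrow> nat \<Rightarrow> (real \<Rightarrow> real) \<Rightarrow> (nat \<Rightarrow> complex mat) \<Rightarrow> (nat \<Rightarrow> complex mat)" where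
  "tfun m p h C = (\<lambda>k. blk m m
     (kron_id (mat_adjoint (dft_mat p)) m * blkdiag m p (\<lambda>a. herm_fun h (fblock m p C a))
        * kron_id (dft_mat p) m) k 0)"

definition flim0 :: "(real \<Rightarrow> real) \<Rightarrow> ereal" where
  "flim0 f = Lim (at_right 0) (\<lambda>x. ereal (f x))"

definition fext :: "(real \<Rightarrow> real) \<Rightarrow> real \<Rightarrow> real" where
  "fext f x = (if 0 < x then f x else real_of_ereal (flim0 f))"

definition sym_gauge :: "nat \<Rightarrow> (real list \<Rightarrow> real) \<Rightarrow> bool" where
  "sym_gauge N \<rho> \<longleftrightarrow>
     (\<forall>x. length x = N \<longrightarrow> (\<rho> x = 0 \<longleftrightarrow> (\<forall>i<N. x ! i = 0))) \<and>
     (\<forall>x c. length x = N \<longrightarrow> \<rho> (map (\<lambda>t. c * t) x) = \<bar>c\<bar> * \<rho> x) \<and>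
     (\<forall>x y. length x = N \<longrightarrow> length y = N \<longrightarrow> \<rho> (map2 (+) x y) \<le> \<rho> x + \<rho> y) \<and>
     (\<forall>x. length x = N \<longrightarrow> \<rho> (map abs x) = \<rho> x) \<and>
     (\<forall>x y. length x = N \<longrightarrow> mset x = mset y \<longrightarrow> \<rho> y = \<rho> x)"

definition tnorm :: "(real list \<Rightarrow> real) \<Rightarrow> nat \<Rightarrow> nat \<Rightarrow> (nat \<Rightarrow> complex mat) \<Rightarrow> real" where
  "tnorm \<rho> m p H = \<rho> (tsval_list m p H)"

definition topnorm :: "nat \<Rightarrow> nat \<Rightarrow> (nat \<Rightarrow> real mat) \<Rightarrow> real" where
  "topnorm m p C = tnorm (\<lambda>xs. Max (insert 0 (set xs))) m p (cplx_tensor C)"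

definition fnorm :: "(real list \<Rightarrow> real) \<Rightarrow> nat \<Rightarrow> nat \<Rightarrow> (real \<Rightarrow> real) \<Rightarrow> (nat \<Rightarrow> real mat) \<Rightarrow> ennreal" where
  "fnorm \<rho> m p f C = (if flim0 f = \<infinity> \<and> 0 \<in> set (teig_list m p C) then \<infinity>
      else ennreal (tnorm \<rho> m p (tfun m p (fext f) (cplx_tensor C))))"

definition eln :: "real \<Rightarrow> ereal" where
  "eln x = (if 0 < x then ereal (ln x) else -\<infinity>)"

definition elog :: "ennreal \<Rightarrow> ereal" where
  "elog x = (if x = \<infinity> then \<infinity> else eln (enn2real x))"

definition eexp :: "ereal \<Rightarrow> ereal" where
  "eexp x = (case x of ereal r \<Rightarrow> ereal (exp r) | PInfty \<Rightarrow> \<infinity> | MInfty \<Rightarrow> 0)"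

definition eint :: "'a measure \<Rightarrow> ('a \<Rightarrow> ereal) \<Rightarrow> ereal" where
  "eint M h = enn2ereal (\<integral>\<^sup>+ x. e2ennreal (h x) \<partial>M) - enn2ereal (\<integral>\<^sup>+ x. e2ennreal (- h x) \<partial>M)"

definition logmaj :: "ereal list \<Rightarrow> ereal list \<Rightarrow> bool" where
  "logmaj x y \<longleftrightarrow> length x = length y \<and>
     (\<forall>k. 1 \<le> k \<and> k \<le> length x \<longrightarrow>
        prod_list (take k (rev (sort x))) \<le> prod_list (take k (rev (sort y)))) \<and>
     prod_list (rev (sort x)) = prod_list (rev (sort y))"

definition sigma_compact_space :: "'a::topological_space itself \<Rightarrow> bool" where
  "sigma_compact_space _ \<longleftrightarrow> (\<exists>K :: nat \<Rightarrow> 'a set. (\<forall>n. compact (K n)) \<and> (\<Union>n. K n) = UNIV)"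

end

(* Writing u = (ln lambda_i), both kinds of bound concern a symmetric convex function Phi of u:
   Phi(u) = rho(g(exp u)) in (iii) and Phi(u) = ln rho(f(exp u)) in (ii). If ln lambda(C) is majorized by
   the mean of ln lambda(D_tau), a subgradient of Phi at ln lambda(C), with its coefficients sorted by
   a permutation, is an affine minorant of Phi whose mean is at least Phi(ln lambda(C)); this is Schur
   convexity and Jensen's inequality in one step, and Phi(ln lambda(D_tau)) need not be measurable.
   Conversely it suffices to know (iii) for x powr s with the Ky Fan norms (s > 0) and the trace norm
   (s < 0): ln z <= (z powr q - 1) / q, and dominated convergence as q tends to 0 gives the sums of
   logarithms; (ii) implies these cases of (iii) by Jensen's inequality. The sorted T-eigenvalues are
   measurable because lambda_j is the limit of (sum_{i >= j} lambda_i^k)^(1/k), and the power sums of all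
   T-eigenvalues are traces of powers of the Fourier blocks. *)
theory Submission
  imports Defs
begin

unbundle no vec_syntax

section \<open>Hermitian matrices\<close>

text \<open>Zero T-eigenvalues are the obstacle behind the extended-valued conventions. In the
  family they occur only on a null set, since the finite moment with q = 1 integrates a norm that is
  infinite there; together with the operator norm bound, the negative moments make every
  \<open>ln (lam \<tau> i)\<close> integrable. For C, positivity has to be extracted from the
  statement at hand: under (i) from the equality of the full products, whose right-hand side is an
  exponential, and under (ii) or (iii) from the exponent -1, where a zero T-eigenvalue would make
  the left-hand side infinite. Negative exponents also supply the reverse inequality for k = N,
  which is the equality demanded by log-majorization. They are paired with the trace norm alone
  because a negative power reverses the order: a Ky Fan norm with k < N would then sum over the
  smallest T-eigenvalues.\<close>

lemma mat_adjoint_dim [simp]: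
  "dim_row (mat_adjoint A) = dim_col A" "dim_col (mat_adjoint A) = dim_row A"
  by (auto simp: mat_adjoint_def mat_of_rows_def)

lemma mat_adjoint_carrier [simp]: "A \<in> carrier_mat n k \<Longrightarrow> mat_adjoint A \<in> carrier_mat k n"
  by (intro carrier_matI) auto

lemma mat_adjoint_index [simp]:
  fixes A :: "complex mat"
  assumes "i < dim_col A" "j < dim_row A"
  shows "mat_adjoint A $$ (i, j) = cnj (A $$ (j, i))"
  using assms by (auto simp: mat_adjoint_def mat_of_rows_def conjugate_complex_def)

lemma mat_adjoint_mult:
  fixes A B :: "complex mat"
  assumes "A \<in> carrier_mat n k" "B \<in> carrier_mat k l"
  shows "mat_adjoint (A * B) = mat_adjoint B * mat_adjoint A"
  using assms by (intro eq_matI) (auto simp: scalar_prod_def mult.commute intro!: sum.cong)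

lemma mat_adjoint_adjoint [simp]: "mat_adjoint (mat_adjoint A) = (A :: complex mat)"
  by (intro eq_matI) auto

lemma mat_adjoint_diag:
  "mat_adjoint (mat_diag n (\<lambda>i. complex_of_real (d i))) = mat_diag n (\<lambda>i. complex_of_real (d i))"
  by (intro eq_matI) (auto simp: mat_diag_def)

lemma unitary_matD:
  assumes "unitary_mat n U"
  shows "U \<in> carrier_mat n n" "mat_adjoint U * U = 1\<^sub>m n" "U * mat_adjoint U = 1\<^sub>m n"
  using assms mat_mult_left_right_inverse[of "mat_adjoint U" n U] by (auto simp: unitary_mat_def)

lemma unitary_mat_mult:
  assumes "unitary_mat n U" "unitary_mat n V"
  shows "unitary_mat n (U * V)"
proof -
  note U = unitary_matD[OF assms(1)] and V = unitary_matD[OF assms(2)]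
  have "mat_adjoint (U * V) * (U * V) = mat_adjoint V * (mat_adjoint U * (U * V))"
    using U(1) V(1) by (simp add: mat_adjoint_mult[of _ n n _ n] assoc_mult_mat[of _ n n _ n _ n])
  also have "mat_adjoint U * (U * V) = (mat_adjoint U * U) * V"
    using U(1) V(1) by (simp add: assoc_mult_mat[of _ n n _ n _ n])
  finally show ?thesis using U V by (auto simp: unitary_mat_def)
qed

lemma unitary_mat_of_cols:
  assumes len: "length us = n" and us: "set us \<subseteq> carrier_vec n"
    and on: "\<And>i j. i < n \<Longrightarrow> j < n \<Longrightarrow> us ! i \<bullet>c us ! j = (if i = j then 1 else 0)"
  shows "unitary_mat n (mat_of_cols n us)"
  unfolding unitary_mat_def
proof (intro conjI eq_matI)
  show "mat_of_cols n us \<in> carrier_mat n n" using len by auto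
  fix i j assume ij: "i < dim_row (1\<^sub>m n :: complex mat)" "j < dim_col (1\<^sub>m n :: complex mat)"
  have c: "us ! i \<in> carrier_vec n" "us ! j \<in> carrier_vec n" using ij len us by auto
  have "(mat_adjoint (mat_of_cols n us) * mat_of_cols n us) $$ (i, j)
      = (\<Sum>k<n. cnj (us ! i $ k) * us ! j $ k)"
    using ij len by (auto simp: scalar_prod_def mat_of_cols_index atLeast0LessThan intro!: sum.cong)
  also have "\<dots> = us ! j \<bullet>c us ! i"
    using c by (auto simp: scalar_prod_def atLeast0LessThan conjugate_complex_def mult.commute intro!: sum.cong)
  also have "\<dots> = 1\<^sub>m n $$ (i, j)" using ij on by auto
  finally show "(mat_adjoint (mat_of_cols n us) * mat_of_cols n us) $$ (i, j) = 1\<^sub>m n $$ (i, j)" .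
qed (use len in auto)

lemma cscalar_prod_self:
  fixes v :: "complex vec"
  shows "v \<bullet>c v = complex_of_real (\<Sum>i<dim_vec v. (cmod (v $ i))\<^sup>2)"
  by (simp add: scalar_prod_def atLeast0LessThan conjugate_complex_def complex_norm_square del: of_real_power)

text \<open>Complete \<open>v\<close> to a basis, orthogonalize by Gram-Schmidt, which keeps the
  first vector, and normalize; \<open>c\<close> is the inverse of the length of \<open>v\<close>.
  This is the change of basis for deflating a Hermitian matrix at an eigenvector.\<close>

lemma unitary_with_first_col:
  fixes v :: "complex vec"
  assumes v: "v \<in> carrier_vec n" and v0: "v \<noteq> 0\<^sub>v n"
  shows "\<exists>U c. unitary_mat n U \<and> col U 0 = c \<cdot>\<^sub>v v"
proof -
  interpret cof_vec_space n "TYPE(complex)" .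
  define b where "b = basis_completion v"
  define ws where "ws = gram_schmidt n b"
  from basis_completion[OF v v0, folded b_def]
  have dist_b: "distinct b" and indep: "\<not> lin_dep (set b)" and b: "set b \<subseteq> carrier_vec n"
    and hdb: "hd b = v" and len_b: "length b = n" by auto
  have n: "n > 0" using v v0 by (cases n) auto
  with hdb len_b obtain vs where bv: "b = v # vs" by (cases b) auto
  from gram_schmidt_result[OF b dist_b indep refl, folded ws_def]
  have ws: "set ws \<subseteq> carrier_vec n" "corthogonal ws" "length ws = n" by (auto simp: len_b)
  from gram_schmidt_hd[OF v, of vs, folded bv] have hdws: "hd ws = v" unfolding ws_def .
  define r where "r w = sqrt (\<Sum>i<n. (cmod (w $ i))\<^sup>2)" for w :: "complex vec"
  define us where "us = map (\<lambda>w. complex_of_real (inverse (r w)) \<cdot>\<^sub>v w) ws"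
  have wsc: "ws ! i \<in> carrier_vec n" if "i < n" for i using ws that by auto
  have r: "w \<bullet>c w = complex_of_real ((r w)\<^sup>2)" if "w \<in> carrier_vec n" for w
    using that unfolding cscalar_prod_self r_def by (simp add: sum_nonneg)
  have "us ! i \<bullet>c us ! j = (if i = j then 1 else 0)" if ij: "i < n" "j < n" for i j
  proof -
    have c: "ws ! i \<in> carrier_vec n" "ws ! j \<in> carrier_vec n" using ij wsc by auto
    have "us ! i \<bullet>c us ! j = complex_of_real (inverse (r (ws ! i)) * inverse (r (ws ! j))) * (ws ! i \<bullet>c ws ! j)"
      using ij c ws(3) unfolding us_def by (simp add: conjugate_smult_vec conjugate_complex_def)
    moreover have "(ws ! i \<bullet>c ws ! j = 0) = (i \<noteq> j)"
      using corthogonalD[OF ws(2)] ij ws(3) by auto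
    ultimately show ?thesis using r[OF c(1)] by (auto simp: power2_eq_square field_simps)
  qed
  moreover have "set us \<subseteq> carrier_vec n" using ws unfolding us_def by auto
  moreover have "length us = n" using ws unfolding us_def by simp
  ultimately have U: "unitary_mat n (mat_of_cols n us)" by (intro unitary_mat_of_cols) auto
  have "us ! 0 = complex_of_real (inverse (r v)) \<cdot>\<^sub>v v"
    using hdws ws(3) n unfolding us_def by (cases ws) auto
  hence "col (mat_of_cols n us) 0 = complex_of_real (inverse (r v)) \<cdot>\<^sub>v v"
    using n ws(3) v unfolding us_def by (subst col_mat_of_cols) auto
  thus ?thesis using U by (intro exI conjI)
qed

lemma complex_eigenvector_exists:
  fixes A :: "complex mat"
  assumes A: "A \<in> carrier_mat n n" and n: "n > 0"
  shows "\<exists>v e. v \<in> carrier_vec n \<and> v \<noteq> 0\<^sub>v n \<and> A *\<^sub>v v = e \<cdot>\<^sub>v v"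
proof -
  have "degree (char_poly A) = n" using degree_monic_char_poly[OF A] by simp
  hence "\<not> constant (poly (char_poly A))" using n by (simp add: constant_degree)
  then obtain e where "poly (char_poly A) e = 0" using fundamental_theorem_of_algebra[of "char_poly A"] by auto
  hence "eigenvalue A e" using eigenvalue_root_char_poly[OF A] by simp
  then obtain v where "eigenvector A v e" unfolding eigenvalue_def by blast
  moreover have "dim_row A = n" using A by simp
  ultimately show ?thesis unfolding eigenvector_def by blast
qed

lemma mult_block_diag:
  assumes "X \<in> carrier_mat k k" "X' \<in> carrier_mat k k" "Y \<in> carrier_mat n n" "Y' \<in> carrier_mat n n"
  shows "four_block_mat X (0\<^sub>m k n) (0\<^sub>m n k) Y * four_block_mat X' (0\<^sub>m k n) (0\<^sub>m n k) Y'
      = four_block_mat (X * X') (0\<^sub>m k n) (0\<^sub>m n k) (Y * Y' :: complex mat)"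
  using assms mult_four_block_mat[of X k k "0\<^sub>m k n" n "0\<^sub>m n k" n Y X' k "0\<^sub>m k n" n "0\<^sub>m n k" Y'] by simp

text \<open>Deflation: in a unitary basis starting with an eigenvector, column 0 of the matrix is
  \<open>e\<close> times the first unit vector. Being Hermitian, the matrix then has a vanishing row
  0 as well, apart from \<open>e\<close>, and splits into a block of size 1 and a Hermitian block of
  size \<open>n\<close> to which the induction hypothesis applies.\<close>

lemma hermitian_diagonalization:
  fixes A :: "complex mat"
  assumes "A \<in> carrier_mat n n" "mat_adjoint A = A"
  shows "\<exists>U d. unitary_mat n U \<and> A = U * mat_diag n (\<lambda>i. complex_of_real (d i)) * mat_adjoint U"
  using assms
proof (induction n arbitrary: A)
  case 0
  have "A = 1\<^sub>m 0 * mat_diag 0 (\<lambda>i. complex_of_real ((\<lambda>_. 0) i)) * mat_adjoint (1\<^sub>m 0)"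
    using 0 by (intro eq_matI) auto
  moreover have "unitary_mat 0 (1\<^sub>m 0)" by (auto simp: unitary_mat_def)
  ultimately show ?case by (intro exI[of _ "1\<^sub>m 0"] exI[of _ "\<lambda>_. 0"] conjI)
next
  case (Suc n)
  let ?N = "Suc n"
  note A = Suc.prems(1)
  obtain v e where v: "v \<in> carrier_vec ?N" "v \<noteq> 0\<^sub>v ?N" and ev: "A *\<^sub>v v = e \<cdot>\<^sub>v v"
    using complex_eigenvector_exists[OF A] by auto
  obtain W c where W: "unitary_mat ?N W" and W0: "col W 0 = c \<cdot>\<^sub>v v"
    using unitary_with_first_col[OF v] by auto
  note Wd = unitary_matD[OF W]
  define M where "M = mat_adjoint W * A * W"
  have M: "M \<in> carrier_mat ?N ?N" unfolding M_def using A Wd(1) by auto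
  have Mh: "mat_adjoint M = M"
    unfolding M_def using A Wd(1) Suc.prems(2)
    by (simp add: mat_adjoint_mult[of _ ?N ?N _ ?N] assoc_mult_mat[of _ ?N ?N _ ?N _ ?N] mult_carrier_mat[of _ ?N ?N _ ?N])
  have Mcol: "col M 0 = e \<cdot>\<^sub>v col (1\<^sub>m ?N) 0"
  proof -
    have "col M 0 = mat_adjoint W *\<^sub>v (A *\<^sub>v col W 0)"
      unfolding M_def using A Wd(1)
      by (subst col_mult2[of _ ?N ?N _ ?N]) (auto intro!: assoc_mult_mat_vec[of _ ?N ?N _ ?N] carrier_vecI)
    also have "A *\<^sub>v col W 0 = e \<cdot>\<^sub>v col W 0"
      unfolding W0 using A v ev
      by (simp add: mult_mat_vec[of _ ?N ?N] smult_smult_assoc mult.commute)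
    also have "mat_adjoint W *\<^sub>v (e \<cdot>\<^sub>v col W 0) = e \<cdot>\<^sub>v (mat_adjoint W *\<^sub>v col W 0)"
      using Wd(1) by (intro mult_mat_vec[of _ ?N ?N]) (auto intro: carrier_vecI)
    also have "mat_adjoint W *\<^sub>v col W 0 = col (mat_adjoint W * W) 0"
      using Wd(1) by (intro col_mult2[of _ ?N ?N _ ?N, symmetric]) auto
    finally show ?thesis using Wd(2) by simp
  qed
  have M0: "M $$ (i, 0) = (if i = 0 then e else 0)" if "i < ?N" for i
  proof -
    have "M $$ (i, 0) = col M 0 $ i" using M that by simp
    thus ?thesis using that unfolding Mcol by auto
  qed
  have Mc: "M $$ (j, i) = cnj (M $$ (i, j))" if "i < ?N" "j < ?N" for i j
    using arg_cong[OF Mh, of "\<lambda>X. X $$ (j, i)"] that M by auto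
  define B where "B = mat n n (\<lambda>(i, j). M $$ (Suc i, Suc j))"
  have B: "B \<in> carrier_mat n n" by (auto simp: B_def)
  have "mat_adjoint B = B"
  proof (intro eq_matI)
    fix i j assume "i < dim_row B" "j < dim_col B"
    thus "mat_adjoint B $$ (i, j) = B $$ (i, j)"
      using B Mc[of "Suc j" "Suc i"] by (auto simp: B_def)
  qed (use B in auto)
  from Suc.IH[OF B this] obtain V d where V: "unitary_mat n V"
    and Bd: "B = V * mat_diag n (\<lambda>i. complex_of_real (d i)) * mat_adjoint V" by auto
  note Vd = unitary_matD[OF V]
  define Z where "Z = four_block_mat (1\<^sub>m 1) (0\<^sub>m 1 n) (0\<^sub>m n 1) V"
  have Z: "Z \<in> carrier_mat ?N ?N" unfolding Z_def
    using four_block_carrier_mat[of "1\<^sub>m 1" 1 1 V n n] Vd(1) by auto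
  have Za: "mat_adjoint Z = four_block_mat (1\<^sub>m 1) (0\<^sub>m 1 n) (0\<^sub>m n 1) (mat_adjoint V)"
    using Vd(1) unfolding Z_def by (intro eq_matI) auto
  have Zu: "unitary_mat ?N Z"
    unfolding unitary_mat_def Za
  proof
    show "four_block_mat (1\<^sub>m 1) (0\<^sub>m 1 n) (0\<^sub>m n 1) (mat_adjoint V) * Z = 1\<^sub>m ?N"
      using Vd unfolding Z_def
      by (simp add: mult_block_diag[of _ "Suc 0" _ _ n])
  qed (rule Z)
  define d' where "d' i = (case i of 0 \<Rightarrow> Re e | Suc j \<Rightarrow> d j)" for i
  \<comment> \<open>The eigenvalue is real because it is a diagonal entry of the Hermitian matrix
    \<open>M\<close>.\<close>
  have eR: "complex_of_real (Re e) = e"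
    using Mc[of 0 0] M0[of 0] by (simp add: complex_eq_iff)
  have D: "mat_diag ?N (\<lambda>i. complex_of_real (d' i))
      = four_block_mat (mat_diag 1 (\<lambda>_. e)) (0\<^sub>m 1 n) (0\<^sub>m n 1) (mat_diag n (\<lambda>i. complex_of_real (d i)))"
    by (intro eq_matI) (auto simp: mat_diag_def d'_def eR split: nat.splits)
  have MB: "M = four_block_mat (mat_diag 1 (\<lambda>_. e)) (0\<^sub>m 1 n) (0\<^sub>m n 1) B"
  proof (intro eq_matI)
    fix i j assume "i < dim_row (four_block_mat (mat_diag 1 (\<lambda>_. e)) (0\<^sub>m 1 n) (0\<^sub>m n 1) B)"
      "j < dim_col (four_block_mat (mat_diag 1 (\<lambda>_. e)) (0\<^sub>m 1 n) (0\<^sub>m n 1) B)"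
    hence "i < ?N" "j < ?N" using B by (auto simp: mat_diag_def)
    thus "M $$ (i, j) = four_block_mat (mat_diag 1 (\<lambda>_. e)) (0\<^sub>m 1 n) (0\<^sub>m n 1) B $$ (i, j)"
      using B M0 Mc[of j 0] by (cases i; cases j) (auto simp: mat_diag_def B_def)
  qed (use M B in \<open>auto simp: mat_diag_def\<close>)
  have MZ: "M = Z * mat_diag ?N (\<lambda>i. complex_of_real (d' i)) * mat_adjoint Z"
    unfolding Za unfolding MB D Z_def Bd using Vd(1)
    by (simp add: mult_block_diag[of _ "Suc 0" _ _ n] left_mult_one_mat[of _ "Suc 0" "Suc 0"]
        right_mult_one_mat[of _ "Suc 0" "Suc 0"] mult_carrier_mat[of V n n])
  let ?D = "mat_diag ?N (\<lambda>i. complex_of_real (d' i))"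
  have "W * M = (W * mat_adjoint W) * (A * W)"
    unfolding M_def using A Wd(1) by (simp add: assoc_mult_mat[of _ ?N ?N _ ?N _ ?N])
  hence "W * M * mat_adjoint W = A * (W * mat_adjoint W)"
    using A Wd by (simp add: assoc_mult_mat[of _ ?N ?N _ ?N _ ?N])
  hence "A = W * M * mat_adjoint W" using A Wd by simp
  also have "\<dots> = (W * Z) * ?D * mat_adjoint (W * Z)"
    unfolding MZ using A Wd(1) Z
    by (simp add: mat_adjoint_mult[of _ ?N ?N _ ?N] assoc_mult_mat[of _ ?N ?N _ ?N _ ?N] mult_carrier_mat[of _ ?N ?N _ ?N])
  finally show ?case using unitary_mat_mult[OF W Zu] by blast
qed

section \<open>Fourier blocks and the functional calculus\<close>

lemma similar_mat_wit_unitary_diag: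
  assumes "unitary_mat n U"
  shows "similar_mat_wit (U * mat_diag n c * mat_adjoint U) (mat_diag n c) U (mat_adjoint U)"
  using unitary_matD[OF assms] by (intro similar_mat_witI[of _ _ n]) (auto intro!: mult_carrier_mat[of _ n n _ n])

lemma proots_prod_linear: "proots (\<Prod>x\<leftarrow>xs. [:- x, 1:]) = mset (xs :: complex list)"
proof (induction xs)
  case (Cons x xs)
  have "(\<Prod>x\<leftarrow>xs. [:- x, 1:]) \<noteq> 0" by (auto simp: prod_list_zero_iff)
  hence "proots ([:- x, 1:] * (\<Prod>x\<leftarrow>xs. [:- x, 1:])) = add_mset x (mset xs)"
    using Cons by (subst proots_mult) auto
  thus ?case by (simp del: mult_pCons_left)
qed simp

lemma eigs_unitary_diag:
  assumes "unitary_mat n U"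
  shows "eigs (U * mat_diag n c * mat_adjoint U) = image_mset c (mset_set {..<n})"
proof -
  have "char_poly (U * mat_diag n c * mat_adjoint U) = char_poly (mat_diag n c)"
    using similar_mat_wit_unitary_diag[OF assms] by (intro char_poly_similar) (auto simp: similar_mat_def)
  also have "\<dots> = (\<Prod>a\<leftarrow>diag_mat (mat_diag n c). [:- a, 1:])"
    by (rule char_poly_upper_triangular[of _ n]) (auto simp: mat_diag_def)
  also have "diag_mat (mat_diag n c) = map c [0..<n]"
    by (auto simp: diag_mat_def mat_diag_def)
  finally have "eigs (U * mat_diag n c * mat_adjoint U) = proots (\<Prod>i\<leftarrow>[0..<n]. [:- c i, 1:])"
    by (simp add: eigs_def o_def)
  also have "\<dots> = image_mset c (mset [0..<n])"
    using proots_prod_linear[of "map c [0..<n]"] by (simp add: o_def)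
  finally show ?thesis by (simp add: mset_upt atLeast0LessThan)
qed

text \<open>Invariance of the trace, in the form of an exchange of the two sums followed by the
  normalization of the columns of \<open>U\<close>. It expresses power sums of the spectrum as
  polynomials in the matrix entries.\<close>

lemma unitary_diag_trace_power:
  assumes U: "unitary_mat n U" and A: "A = U * mat_diag n c * mat_adjoint U"
  shows "(\<Sum>i<n. (A ^\<^sub>m k) $$ (i, i)) = (\<Sum>i<n. c i ^ k)"
proof -
  note Ud = unitary_matD[OF U]
  have D: "mat_diag n c ^\<^sub>m k = mat_diag n (\<lambda>i. c i ^ k)"
  proof (induction k)
    case 0
    show ?case by (simp add: mat_diag_def one_mat_def)
  qed (simp add: mult.commute)
  have "A ^\<^sub>m k = U * mat_diag n (\<lambda>i. c i ^ k) * mat_adjoint U"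
    unfolding A D[symmetric] by (rule similar_mat_wit_pow_id[OF similar_mat_wit_unitary_diag[OF U]])
  hence "(\<Sum>i<n. (A ^\<^sub>m k) $$ (i, i)) = (\<Sum>i<n. \<Sum>j<n. U $$ (i, j) * c j ^ k * cnj (U $$ (i, j)))"
    using Ud(1) by (auto simp: mat_diag_mult_right[of _ n n] scalar_prod_def atLeast0LessThan intro!: sum.cong)
  also have "\<dots> = (\<Sum>j<n. c j ^ k * (\<Sum>i<n. cnj (U $$ (i, j)) * U $$ (i, j)))"
    by (subst sum.swap) (auto simp: sum_distrib_left mult_ac intro!: sum.cong)
  also have "\<dots> = (\<Sum>j<n. c j ^ k * (mat_adjoint U * U) $$ (j, j))"
    using Ud(1) by (auto simp: scalar_prod_def atLeast0LessThan intro!: sum.cong)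
  finally show ?thesis unfolding Ud(2) by simp
qed

text \<open>Writing D for the real diagonal factor, the inner unitary factors of
  \<open>mat_adjoint A * A\<close> cancel and leave D squared in the same basis; the root of a
  square is the absolute value.\<close>

lemma svals_unitary_diag:
  assumes U: "unitary_mat n U"
  shows "svals (U * mat_diag n (\<lambda>i. complex_of_real (h i)) * mat_adjoint U)
    = image_mset (\<lambda>i. \<bar>h i\<bar>) (mset_set {..<n})"
proof -
  note Ud = unitary_matD[OF U]
  let ?D = "mat_diag n (\<lambda>i. complex_of_real (h i))"
  have UD: "U * ?D \<in> carrier_mat n n" "?D * mat_adjoint U \<in> carrier_mat n n"
    using Ud(1) by (auto intro!: mult_carrier_mat[of _ n n _ n])
  have "mat_adjoint (U * ?D * mat_adjoint U) = U * (?D * mat_adjoint U)"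
    using Ud(1) UD by (simp add: mat_adjoint_mult[of _ n n _ n] mat_adjoint_diag)
  hence "mat_adjoint (U * ?D * mat_adjoint U) * (U * ?D * mat_adjoint U)
      = (U * (?D * mat_adjoint U)) * (U * (?D * mat_adjoint U))"
    using Ud(1) by (simp add: assoc_mult_mat[of U n n _ n _ n])
  also have "\<dots> = U * ((?D * mat_adjoint U) * (U * (?D * mat_adjoint U)))"
    using Ud(1) UD by (intro assoc_mult_mat[of _ n n _ n _ n]) (auto intro!: mult_carrier_mat[of _ n n _ n])
  also have "(?D * mat_adjoint U) * (U * (?D * mat_adjoint U)) = ?D * (mat_adjoint U * (U * (?D * mat_adjoint U)))"
    using Ud(1) UD by (intro assoc_mult_mat[of _ n n _ n _ n]) (auto intro!: mult_carrier_mat[of _ n n _ n])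
  also have "mat_adjoint U * (U * (?D * mat_adjoint U)) = (mat_adjoint U * U) * (?D * mat_adjoint U)"
    using Ud(1) UD by (intro assoc_mult_mat[of _ n n _ n _ n, symmetric]) auto
  also have "\<dots> = ?D * mat_adjoint U" using left_mult_one_mat[OF UD(2)] unfolding Ud(2) .
  also have "?D * (?D * mat_adjoint U) = (?D * ?D) * mat_adjoint U"
    using Ud(1) by (intro assoc_mult_mat[of _ n n _ n _ n, symmetric]) auto
  also have "?D * ?D = mat_diag n (\<lambda>i. complex_of_real ((h i)\<^sup>2))"
    by (simp add: power2_eq_square)
  also have "U * (\<dots> * mat_adjoint U) = U * \<dots> * mat_adjoint U"
    using Ud(1) by (intro assoc_mult_mat[of _ n n _ n _ n, symmetric]) auto
  finally show ?thesis
    by (simp add: svals_def eigs_unitary_diag[OF U] image_mset.compositionality o_def del: of_real_power)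
qed

section \<open>Block-circulant matrices under the discrete Fourier transform\<close>

lemma sum_lessThan_mult:
  "(\<Sum>s<p * m. f s) = (\<Sum>a<p. \<Sum>r<m. f (a * m + r :: nat))"
proof -
  have "(\<Sum>s<p * m. f s) = (\<Sum>a<p. sum f {a * m..<a * m + m})" by (rule sum.nat_group[symmetric])
  moreover have "sum f {a * m..<a * m + m} = (\<Sum>r<m. f (a * m + r))" for a
    using sum.shift_bounds_nat_ivl[of f 0 "a * m" m] by (simp add: atLeast0LessThan add.commute)
  ultimately show ?thesis by simp
qed

lemma block_index_less: "a < p \<Longrightarrow> i < m \<Longrightarrow> a * m + i < p * (m :: nat)"
  using mult_le_mono1[of "Suc a" p m] by simp

text \<open>A Kronecker factor with the identity combines whole blocks, so only the rows with the
  same offset \<open>i\<close> inside their block contribute.\<close>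

lemma kron_id_mult_left:
  assumes F: "F \<in> carrier_mat p p" and M: "M \<in> carrier_mat (p * m) q"
    and a: "a < p" and i: "i < m" and s: "s < q"
  shows "(kron_id F m * M) $$ (a * m + i, s) = (\<Sum>b<p. F $$ (a, b) * M $$ (b * m + i, s))"
proof -
  have "(kron_id F m * M) $$ (a * m + i, s)
      = (\<Sum>t<p * m. (if i = t mod m then F $$ (a, t div m) else 0) * M $$ (t, s))"
    using assms block_index_less[OF a i]
    by (auto simp: scalar_prod_def kron_id_def atLeast0LessThan intro!: sum.cong)
  also have "\<dots> = (\<Sum>b<p. \<Sum>r<m. (if i = r then F $$ (a, b) * M $$ (b * m + r, s) else 0))"
    unfolding sum_lessThan_mult by (intro sum.cong refl) (simp add: div_mult_self3)
  also have "\<dots> = (\<Sum>b<p. F $$ (a, b) * M $$ (b * m + i, s))"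
    using i by (simp add: sum.delta)
  finally show ?thesis .
qed

lemma kron_id_mult_right:
  assumes F: "F \<in> carrier_mat p p" and M: "M \<in> carrier_mat q (p * m)"
    and a: "a < p" and i: "i < m" and s: "s < q"
  shows "(M * kron_id F m) $$ (s, a * m + i) = (\<Sum>b<p. M $$ (s, b * m + i) * F $$ (b, a))"
proof -
  have "(M * kron_id F m) $$ (s, a * m + i)
      = (\<Sum>t<p * m. M $$ (s, t) * (if t mod m = i then F $$ (t div m, a) else 0))"
    using assms block_index_less[OF a i]
    by (auto simp: scalar_prod_def kron_id_def atLeast0LessThan intro!: sum.cong)
  also have "\<dots> = (\<Sum>b<p. \<Sum>r<m. (if r = i then M $$ (s, b * m + r) * F $$ (b, a) else 0))"
    unfolding sum_lessThan_mult by (intro sum.cong refl) (simp add: div_mult_self3)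
  also have "\<dots> = (\<Sum>b<p. M $$ (s, b * m + i) * F $$ (b, a))"
    using i by (simp add: sum.delta)
  finally show ?thesis .
qed

lemma kron_id_carrier [simp]: "F \<in> carrier_mat p p \<Longrightarrow> kron_id F m \<in> carrier_mat (p * m) (p * m)"
  by (auto simp: kron_id_def)

text \<open>The primitive root of unity of order \<open>p\<close>; the entries of
  \<open>dft_mat\<close> are powers of its conjugate, up to the normalization.\<close>

definition root1 :: "nat \<Rightarrow> complex" where "root1 p = cis (2 * pi / real p)"

lemma root1_power: "0 < p \<Longrightarrow> root1 p ^ p = 1"
  by (simp add: root1_def Complex.DeMoivre)

lemma root1_cnj: "cnj (root1 p) * root1 p = 1" "root1 p * cnj (root1 p) = 1" "root1 p \<noteq> 0"
  by (auto simp: root1_def cis_cnj cis_mult)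

lemma root1_inj: "a < p \<Longrightarrow> b < p \<Longrightarrow> root1 p ^ a = root1 p ^ b \<Longrightarrow> a = b"
  using Complex.bij_betw_roots_unity[of p] unfolding bij_betw_def inj_on_def
  by (auto simp: root1_def Complex.DeMoivre mult_ac)

lemma root1_power_mod: "0 < p \<Longrightarrow> cnj (root1 p) ^ (a * (k mod p)) = cnj (root1 p) ^ (a * k)"
proof -
  assume p: "0 < p"
  have 1: "cnj (root1 p) ^ p = 1" using root1_power[OF p] by (metis complex_cnj_one complex_cnj_power)
  have "cnj (root1 p) ^ (a * k) = cnj (root1 p) ^ (a * (k mod p) + p * (a * (k div p)))"
    by (rule arg_cong[where f = "\<lambda>e. cnj (root1 p) ^ e"])
      (metis distrib_left mod_mult_div_eq mult.left_commute)
  also have "\<dots> = cnj (root1 p) ^ (a * (k mod p))" unfolding power_add power_mult 1 by simp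
  finally show ?thesis by simp
qed

lemma dft_mat_carrier [simp]: "dft_mat p \<in> carrier_mat p p"
  by (simp add: dft_mat_def)

lemma dft_mat_index:
  "a < p \<Longrightarrow> b < p \<Longrightarrow> dft_mat p $$ (a, b) = cnj (root1 p) ^ (a * b) / complex_of_real (sqrt (real p))"
  by (simp add: dft_mat_def root1_def cis_cnj Complex.DeMoivre field_simps)

lemma dft_mat_adjoint_index:
  "a < p \<Longrightarrow> b < p \<Longrightarrow> mat_adjoint (dft_mat p) $$ (a, b) = root1 p ^ (a * b) / complex_of_real (sqrt (real p))"
  by (subst mat_adjoint_index) (auto simp: dft_mat_index mult.commute, simp_all add: dft_mat_def)

lemma sqrt_sqrt_complex: "0 < p \<Longrightarrow> complex_of_real (sqrt (real p)) * complex_of_real (sqrt (real p)) = of_nat p"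
  by (metis abs_of_nat of_real_mult of_real_of_nat_eq real_sqrt_mult_self)

lemma bcirc_carrier [simp]: "bcirc m n p H \<in> carrier_mat (p * m) (p * n)"
  by (simp add: bcirc_def mult.commute)

lemma bcirc_index:
  assumes "a < p" "b < p" "i < m" "j < m"
  shows "bcirc m m p H $$ (a * m + i, b * m + j) = H ((a + p - b) mod p) $$ (i, j)"
  using assms block_index_less[OF assms(1,3)] block_index_less[OF assms(2,4)]
  by (auto simp: bcirc_def mult.commute)

lemma fblock_carrier [simp]: "fblock m p H a \<in> carrier_mat m m"
  by (simp add: fblock_def blk_def)

text \<open>The Fourier blocks are the unnormalized discrete Fourier transform of the frontal
  slices. The two normalizing factors combine to 1/p, and each of the \<open>p\<close> block columns
  contributes the same sum over the slices, since the block in position (c, b) depends only on c - b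
  modulo p.\<close>

lemma fblock_index:
  assumes a: "a < p" and i: "i < m" and j: "j < m"
  shows "fblock m p H a $$ (i, j) = (\<Sum>k<p. cnj (root1 p) ^ (a * k) * H k $$ (i, j))"
proof -
  have p: "0 < p" using a by simp
  let ?W = "kron_id (dft_mat p) m" and ?V = "kron_id (mat_adjoint (dft_mat p)) m" and ?r = "root1 p"
  let ?q = "complex_of_real (sqrt (real p))"
  have W: "?W \<in> carrier_mat (p * m) (p * m)" and V: "?V \<in> carrier_mat (p * m) (p * m)" by auto
  have WB: "?W * bcirc m m p H \<in> carrier_mat (p * m) (p * m)"
    by (rule mult_carrier_mat[OF W]) simp
  note less = block_index_less[OF a i] block_index_less[OF a j]
  have "fblock m p H a $$ (i, j)
      = (\<Sum>b<p. (\<Sum>c<p. dft_mat p $$ (a, c) * bcirc m m p H $$ (c * m + i, b * m + j)) * mat_adjoint (dft_mat p) $$ (b, a))"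
    using i j less by (simp add: fblock_def blk_def kron_id_mult_right[OF _ WB a j less(1)]
      kron_id_mult_left[OF _ bcirc_carrier a i] block_index_less)
  \<comment> \<open>The summand \<open>p\<close> keeps the subtraction of natural numbers from being
    truncated; as an exponent it is invisible, because the root has order \<open>p\<close>.\<close>
  also have "\<dots> = (\<Sum>b<p. \<Sum>c<p. cnj ?r ^ (a * ((c + p - b) mod p)) * H ((c + p - b) mod p) $$ (i, j)) / of_nat p"
    unfolding sum_divide_distrib sum_distrib_right
  proof (intro sum.cong refl, goal_cases)
    case (1 b c)
    hence b: "b < p" and c: "c < p" by auto
    have "cnj ?r ^ (a * c) * ?r ^ (b * a) = cnj ?r ^ (a * (c + p - b))"
    proof -
      have 1: "cnj ?r ^ p = 1" using root1_power[OF p] by (metis complex_cnj_one complex_cnj_power)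
      have "cnj ?r ^ (a * (c + p - b)) * cnj ?r ^ (a * b) = cnj ?r ^ (a * (c + p))"
        using b by (simp flip: power_add distrib_left)
      also have "\<dots> = cnj ?r ^ (a * c)"
        by (simp add: distrib_left power_add mult.commute[of a p] power_mult 1)
      finally have "cnj ?r ^ (a * c) * ?r ^ (b * a)
          = cnj ?r ^ (a * (c + p - b)) * (cnj ?r ^ (a * b) * ?r ^ (a * b))"
        by (simp add: mult_ac)
      thus ?thesis by (simp add: root1_cnj flip: power_mult_distrib)
    qed
    thus ?case using a b c i j
      by (simp add: bcirc_index dft_mat_index dft_mat_adjoint_index root1_power_mod[OF p]
        sqrt_sqrt_complex[OF p, symmetric] mult_ac)
  qed
  finally have "fblock m p H a $$ (i, j) = (\<Sum>b<p. \<Sum>c<p. cnj ?r ^ (a * ((c + p - b) mod p)) * H ((c + p - b) mod p) $$ (i, j)) / of_nat p" .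
  moreover have "(\<Sum>c<p. cnj ?r ^ (a * ((c + p - b) mod p)) * H ((c + p - b) mod p) $$ (i, j))
     = (\<Sum>k<p. cnj ?r ^ (a * k) * H k $$ (i, j))" if "b \<in> {..<p}" for b
  proof (rule sum.reindex_bij_witness[where i = "\<lambda>k. (k + b) mod p" and j = "\<lambda>c. (c + p - b) mod p"])
    fix c assume "c \<in> {..<p}"
    thus "((c + p - b) mod p + b) mod p = c" using that by (simp add: mod_simps)
  next
    fix k assume k: "k \<in> {..<p}"
    show "((k + b) mod p + p - b) mod p = k"
    proof (cases "k + b < p")
      case False
      hence "(k + b) mod p = k + b - p" using k that by (simp add: mod_if)
      thus ?thesis using k that False by simp
    qed (use k that in simp)
  qed (use p in auto)
  ultimately show ?thesis using p by simp
qed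

text \<open>The slices of \<open>tfun\<close> are the inverse Fourier transform of the transformed
  blocks: block column 0 meets only the constant column of the DFT matrix, whose entries are 1 /
  sqrt p, and a second such factor comes from the adjoint.\<close>

lemma tfun_index:
  assumes k: "k < p" and i: "i < m" and j: "j < m"
  shows "tfun m p h H k $$ (i, j)
    = (\<Sum>b<p. root1 p ^ (b * k) * herm_fun h (fblock m p H b) $$ (i, j)) / of_nat p"
proof -
  have p: "0 < p" using k by simp
  define B where "B b = herm_fun h (fblock m p H b)" for b
  let ?W = "kron_id (dft_mat p) m" and ?V = "kron_id (mat_adjoint (dft_mat p)) m"
  have V: "?V \<in> carrier_mat (p * m) (p * m)" by auto
  have Bc: "blkdiag m p B \<in> carrier_mat (p * m) (p * m)" by (simp add: blkdiag_def mult.commute)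
  have VB: "?V * blkdiag m p B \<in> carrier_mat (p * m) (p * m)" by (rule mult_carrier_mat[OF V Bc])
  have Bi: "blkdiag m p B $$ (c * m + i, b * m + j) = (if c = b then B b $$ (i, j) else 0)"
    if "c < p" "b < p" for b c
    using block_index_less[OF that(1) i] block_index_less[OF that(2) j] i j
    by (simp add: blkdiag_def mult.commute)
  note less = block_index_less[OF k i] block_index_less[OF p j]
  have "tfun m p h H k $$ (i, j) = (\<Sum>b<p. (\<Sum>c<p. mat_adjoint (dft_mat p) $$ (k, c) * blkdiag m p B $$ (c * m + i, b * m + j)) * dft_mat p $$ (b, 0))"
    using i j less kron_id_mult_right[OF dft_mat_carrier VB p j less(1)]
    by (simp add: tfun_def blk_def kron_id_mult_left[OF _ Bc k i] block_index_less flip: B_def)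
  also have "\<dots> = (\<Sum>b<p. mat_adjoint (dft_mat p) $$ (k, b) * B b $$ (i, j) * dft_mat p $$ (b, 0))"
    by (intro sum.cong refl) (simp add: Bi if_distrib[of "\<lambda>x. _ * x"] cong: if_cong)
  also have "\<dots> = (\<Sum>b<p. root1 p ^ (b * k) * B b $$ (i, j)) / of_nat p"
    unfolding sum_divide_distrib using k p
    by (intro sum.cong refl)
      (simp add: dft_mat_index dft_mat_adjoint_index sqrt_sqrt_complex[OF p, symmetric] mult_ac)
  finally show ?thesis unfolding B_def .
qed

text \<open>Fourier inversion: composing the transform of the slices with its inverse returns the
  blocks, by orthogonality of the characters of the cyclic group. The assumption \<open>c\<close>
  fixes the dimensions of the matrices that \<open>herm_fun\<close> selects.\<close>

lemma fblock_tfun: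
  assumes a: "a < p" and c: "\<And>b. b < p \<Longrightarrow> herm_fun h (fblock m p H b) \<in> carrier_mat m m"
  shows "fblock m p (tfun m p h H) a = herm_fun h (fblock m p H a)"
proof (intro eq_matI)
  have p: "0 < p" using a by simp
  let ?r = "root1 p"
  fix i j assume "i < dim_row (herm_fun h (fblock m p H a))" "j < dim_col (herm_fun h (fblock m p H a))"
  hence i: "i < m" and j: "j < m" using c[OF a] by auto
  define B where "B b = herm_fun h (fblock m p H b) $$ (i, j)" for b
  have orth: "(\<Sum>k<p. cnj ?r ^ (a * k) * ?r ^ (b * k)) = (if a = b then of_nat p else 0)" if "b < p" for b
  proof (cases "a = b")
    case True
    thus ?thesis by (simp add: root1_cnj flip: power_mult_distrib)
  next
    case False
    \<comment> \<open>For distinct \<open>a\<close> and \<open>b\<close> this is a root of unity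
      other than 1, so its geometric sum over a full period vanishes.\<close>
    define x where "x = cnj ?r ^ a * ?r ^ b"
    have "x \<noteq> 1"
    proof
      assume "x = 1"
      hence "?r ^ a * x = ?r ^ a" by simp
      moreover have "?r ^ a * x = ?r ^ b"
        unfolding x_def by (simp add: root1_cnj mult.assoc[symmetric] flip: power_mult_distrib)
      ultimately show False using root1_inj[OF a that] False by simp
    qed
    moreover have "x ^ p = 1"
    proof -
      have "cnj ?r ^ p = 1" using root1_power[OF p] by (metis complex_cnj_one complex_cnj_power)
      thus ?thesis using root1_power[OF p]
        unfolding x_def by (simp add: power_mult_distrib mult.commute[of _ p] power_mult flip: power_mult[of _ a p] power_mult[of _ b p])
    qed
    ultimately have "(\<Sum>k<p. x ^ k) = 0" by (simp add: sum_gp_strict)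
    thus ?thesis using False by (simp add: x_def power_mult_distrib power_mult)
  qed
  have "fblock m p (tfun m p h H) a $$ (i, j)
      = (\<Sum>k<p. \<Sum>b<p. cnj ?r ^ (a * k) * ?r ^ (b * k) * B b) / of_nat p"
    unfolding fblock_index[OF a i j] sum_divide_distrib
    by (intro sum.cong refl) (simp add: tfun_index i j sum_distrib_left sum_divide_distrib mult_ac flip: B_def)
  also have "\<dots> = (\<Sum>b<p. (\<Sum>k<p. cnj ?r ^ (a * k) * ?r ^ (b * k)) * B b) / of_nat p"
    by (subst sum.swap) (simp add: sum_distrib_right)
  also have "\<dots> = (\<Sum>b<p. if a = b then of_nat p * B b else 0) / of_nat p"
    by (intro arg_cong2[where f = "(/)"] sum.cong refl) (simp add: orth)
  also have "\<dots> = B a" using a p by simp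
  finally show "fblock m p (tfun m p h H) a $$ (i, j) = herm_fun h (fblock m p H a) $$ (i, j)"
    unfolding B_def .
qed (use c[OF a] carrier_matD[OF fblock_carrier] in auto)

text \<open>\<open>herm_fun\<close> is a choice; by the spectral theorem the choice is from a
  nonempty set, so the selected matrix comes with a diagonalization of \<open>A\<close>. All five
  facts are read off this one diagonalization, and on the right they mention only the multiset of
  eigenvalues, which depends on \<open>A\<close> alone.\<close>

lemma hermitian_eigs_facts:
  assumes "A \<in> carrier_mat m m" "mat_adjoint A = A"
  shows herm_fun_carrier: "herm_fun h A \<in> carrier_mat m m"
    and svals_herm_fun: "svals (herm_fun h A) = image_mset (\<lambda>z. \<bar>h (Re z)\<bar>) (eigs A)"
    and svals_hermitian: "svals A = image_mset (\<lambda>z. \<bar>Re z\<bar>) (eigs A)"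
    and size_eigs_hermitian: "size (eigs A) = m"
    and trace_power_hermitian: "Re (\<Sum>i<m. (A ^\<^sub>m k) $$ (i, i)) = (\<Sum>z\<in>#eigs A. Re z ^ k)"
proof -
  let ?P = "\<lambda>B. \<exists>U d. unitary_mat m U \<and> A = U * mat_diag m (\<lambda>i. complex_of_real (d i)) * mat_adjoint U \<and>
        B = U * mat_diag m (\<lambda>i. complex_of_real (h (d i))) * mat_adjoint U"
  obtain V e where V: "unitary_mat m V" and Ae: "A = V * mat_diag m (\<lambda>i. complex_of_real (e i)) * mat_adjoint V"
    using hermitian_diagonalization[OF assms] by auto
  have hf: "herm_fun h A = (SOME B. ?P B)" using assms(1) by (simp add: herm_fun_def)
  have "?P (V * mat_diag m (\<lambda>i. complex_of_real (h (e i))) * mat_adjoint V)"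
    using V Ae by (intro exI[of _ V] exI[of _ e]) simp
  hence "?P (herm_fun h A)" unfolding hf by (rule someI)
  then obtain U d where U: "unitary_mat m U" and A: "A = U * mat_diag m (\<lambda>i. complex_of_real (d i)) * mat_adjoint U"
    and B: "herm_fun h A = U * mat_diag m (\<lambda>i. complex_of_real (h (d i))) * mat_adjoint U" by auto
  have eA: "eigs A = image_mset (\<lambda>i. complex_of_real (d i)) (mset_set {..<m})"
    unfolding A by (rule eigs_unitary_diag[OF U])
  show "herm_fun h A \<in> carrier_mat m m"
    unfolding B using unitary_matD[OF U] by (auto intro!: mult_carrier_mat[of _ m m _ m])
  show "svals (herm_fun h A) = image_mset (\<lambda>z. \<bar>h (Re z)\<bar>) (eigs A)"
    unfolding eA B svals_unitary_diag[OF U] by (simp add: image_mset.compositionality o_def)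
  have "svals A = image_mset (\<lambda>i. \<bar>d i\<bar>) (mset_set {..<m})"
    unfolding A by (rule svals_unitary_diag[OF U])
  thus "svals A = image_mset (\<lambda>z. \<bar>Re z\<bar>) (eigs A)"
    unfolding eA by (simp add: image_mset.compositionality o_def)
  show "size (eigs A) = m" unfolding eA by simp
  have "(\<Sum>i<m. (A ^\<^sub>m k) $$ (i, i)) = complex_of_real (\<Sum>i<m. d i ^ k)"
    unfolding of_real_sum of_real_power by (rule unitary_diag_trace_power[OF U A])
  hence "Re (\<Sum>i<m. (A ^\<^sub>m k) $$ (i, i)) = (\<Sum>i<m. d i ^ k)" by (simp only: Re_complex_of_real)
  thus "Re (\<Sum>i<m. (A ^\<^sub>m k) $$ (i, i)) = (\<Sum>z\<in>#eigs A. Re z ^ k)"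
    unfolding eA sum_unfold_sum_mset image_mset.compositionality o_def Re_complex_of_real .
qed

section \<open>T-eigenvalues and T-singular values of symmetric tensors\<close>

lemma tsym_entry:
  assumes "tsym m p C" and k: "k < p" and i: "i < m" and j: "j < m"
  shows "C k $$ (i, j) = C ((p - k) mod p) $$ (j, i)"
proof -
  have p: "0 < p" using k by simp
  have "bcirc m m p C $$ (k * m + i, 0 * m + j) = bcirc m m p C $$ (0 * m + j, k * m + i)"
    using assms(1) carrier_matD[OF bcirc_carrier[of m m p C]] block_index_less[OF k i] block_index_less[OF p j]
    unfolding tsym_def by (metis index_transpose_mat(1))
  thus ?thesis using k p i j unfolding bcirc_index[OF k p i j] bcirc_index[OF p k j i] by simp
qed

lemma cplx_tensor_index:
  "tensor_dims m m p C \<Longrightarrow> k < p \<Longrightarrow> i < m \<Longrightarrow> j < m \<Longrightarrow> cplx_tensor C k $$ (i, j) = complex_of_real (C k $$ (i, j))"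
  by (auto simp: cplx_tensor_def tensor_dims_def)

text \<open>Conjugation turns the transform at slice index k into the one at -k modulo p, and
  symmetry of the tensor says that the slice at -k is the transpose of the slice at k. The
  involution k to \<open>(p - k) mod p\<close> therefore matches the two sums.\<close>

lemma fblock_hermitian:
  assumes C: "tsym m p C" and a: "a < p"
  shows "mat_adjoint (fblock m p (cplx_tensor C) a) = fblock m p (cplx_tensor C) a"
proof (intro eq_matI)
  let ?A = "fblock m p (cplx_tensor C) a" and ?r = "root1 p"
  have p: "0 < p" using a by simp
  have 1: "?r ^ p = 1" "cnj ?r ^ p = 1" using root1_power[OF p]
    by (auto simp flip: complex_cnj_power)
  have invol: "(p - (p - k) mod p) mod p = k" if "k < p" for k
    using that by (cases "k = 0") simp_all
  have dims: "tensor_dims m m p C" using C by (simp add: tsym_def)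
  fix i j assume "i < dim_row ?A" "j < dim_col ?A"
  hence i: "i < m" and j: "j < m" using carrier_matD[OF fblock_carrier[of m p "cplx_tensor C" a]] by auto
  have "mat_adjoint ?A $$ (i, j) = cnj (?A $$ (j, i))"
    using i j carrier_matD[OF fblock_carrier[of m p "cplx_tensor C" a]] by simp
  also have "\<dots> = (\<Sum>k<p. ?r ^ (a * k) * C k $$ (j, i))"
    using i j by (simp add: fblock_index[OF a j i] cplx_tensor_index[OF dims])
  also have "\<dots> = (\<Sum>k<p. cnj ?r ^ (a * k) * C k $$ (i, j))"
  proof (rule sum.reindex_bij_witness[where i = "\<lambda>k. (p - k) mod p" and j = "\<lambda>k. (p - k) mod p"])
    fix k assume "k \<in> {..<p}"
    hence k: "k < p" by simp
    have "cnj ?r ^ (a * ((p - k) mod p)) = cnj ?r ^ (a * (p - k)) * (cnj ?r ^ (a * k) * ?r ^ (a * k))"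
      by (simp add: root1_power_mod[OF p] root1_cnj flip: power_mult_distrib)
    also have "\<dots> = cnj ?r ^ (a * p) * ?r ^ (a * k)"
      using k by (simp flip: power_add distrib_left mult.assoc)
    finally show "cnj ?r ^ (a * ((p - k) mod p)) * C ((p - k) mod p) $$ (i, j) = ?r ^ (a * k) * C k $$ (j, i)"
      using tsym_entry[OF C k j i] by (simp add: mult.commute[of a p] power_mult 1)
  qed (use invol p in simp_all)
  also have "\<dots> = ?A $$ (i, j)"
    using i j by (simp add: fblock_index[OF a i j] cplx_tensor_index[OF dims])
  finally show "mat_adjoint ?A $$ (i, j) = ?A $$ (i, j)" .
qed (use carrier_matD[OF fblock_carrier[of m p "cplx_tensor C" a]] in auto)

lemma mset_teig_list: "mset (teig_list m p C) = (\<Sum>a<p. image_mset Re (eigs (fblock m p (cplx_tensor C) a)))"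
  by (simp add: teig_list_def teigs_def)

lemma sorted_teig_list: "sorted (rev (teig_list m p C))"
  by (simp add: teig_list_def)

lemma image_mset_sum: "image_mset f (sum g A) = (\<Sum>a\<in>A. image_mset f (g a))"
  by (induction A rule: infinite_finite_induct) auto

lemma size_sum_mset: "size (sum g A) = (\<Sum>a\<in>A. size (g a :: 'b multiset))"
  by (induction A rule: infinite_finite_induct) auto

lemma sum_mset_sum: "sum_mset (sum g A) = (\<Sum>a\<in>A. sum_mset (g a :: 'b :: comm_monoid_add multiset))"
  by (induction A rule: infinite_finite_induct) auto

context
  fixes m p :: nat and C :: "nat \<Rightarrow> real mat"
  assumes C: "tsym m p C"
begin

lemma length_teig_list: "length (teig_list m p C) = m * p"
proof -
  have "size (mset (teig_list m p C)) = (\<Sum>a<p. m)"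
    unfolding mset_teig_list size_sum_mset
    using size_eigs_hermitian[OF fblock_carrier fblock_hermitian[OF C]] by simp
  thus ?thesis by simp
qed

text \<open>Each Fourier block of h(C) is the functional calculus of the corresponding block of C.
  From here on a norm of h(C) is a function of the T-eigenvalues of C alone.\<close>

lemma mset_tsval_list_tfun:
  "mset (tsval_list m p (tfun m p h (cplx_tensor C))) = image_mset (\<lambda>x. \<bar>h x\<bar>) (mset (teig_list m p C))"
proof -
  have "svals (fblock m p (tfun m p h (cplx_tensor C)) a)
      = image_mset (\<lambda>x. \<bar>h x\<bar>) (image_mset Re (eigs (fblock m p (cplx_tensor C) a)))" if "a < p" for a
    using svals_herm_fun[OF fblock_carrier fblock_hermitian[OF C that]]
      fblock_tfun[OF that herm_fun_carrier[OF fblock_carrier fblock_hermitian[OF C]]]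
    by (simp add: image_mset.compositionality o_def)
  thus ?thesis by (simp add: tsval_list_def mset_teig_list image_mset_sum)
qed

lemma mset_tsval_list:
  "mset (tsval_list m p (cplx_tensor C)) = image_mset abs (mset (teig_list m p C))"
  using svals_hermitian[OF fblock_carrier fblock_hermitian[OF C]]
  by (simp add: tsval_list_def mset_teig_list image_mset_sum image_mset.compositionality o_def)

lemma sum_power_teig_list:
  "(\<Sum>x\<leftarrow>teig_list m p C. x ^ k) = Re (\<Sum>a<p. \<Sum>i<m. (fblock m p (cplx_tensor C) a ^\<^sub>m k) $$ (i, i))"
proof -
  have "(\<Sum>x\<leftarrow>teig_list m p C. x ^ k) = (\<Sum>x\<in>#mset (teig_list m p C). x ^ k)"
    by (metis mset_map sum_mset_sum_list)
  also have "\<dots> = (\<Sum>a<p. \<Sum>z\<in>#eigs (fblock m p (cplx_tensor C) a). Re z ^ k)"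
    unfolding mset_teig_list image_mset_sum sum_mset_sum
    by (simp add: image_mset.compositionality o_def)
  also have "\<dots> = (\<Sum>a<p. Re (\<Sum>i<m. (fblock m p (cplx_tensor C) a ^\<^sub>m k) $$ (i, i)))"
    by (intro sum.cong refl trace_power_hermitian[OF fblock_carrier fblock_hermitian[OF C], symmetric]) auto
  finally show ?thesis by simp
qed

end

section \<open>Convex functions of finitely many coordinates\<close>

text \<open>Points are functions on the natural numbers, so that coordinates can be eliminated one
  by one in an induction without a change of type.\<close>

definition coord_convex :: "((nat \<Rightarrow> real) \<Rightarrow> real) \<Rightarrow> bool" where
  "coord_convex \<Phi> \<longleftrightarrow> (\<forall>u v t. 0 \<le> t \<and> t \<le> 1 \<longrightarrow>
     \<Phi> (\<lambda>i. (1 - t) * u i + t * v i) \<le> (1 - t) * \<Phi> u + t * \<Phi> v)"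

lemma coord_convexD:
  "coord_convex \<Phi> \<Longrightarrow> 0 \<le> t \<Longrightarrow> t \<le> 1 \<Longrightarrow>
    \<Phi> (\<lambda>i. (1 - t) * u i + t * v i) \<le> (1 - t) * \<Phi> u + t * \<Phi> v"
  by (auto simp: coord_convex_def)

lemma convex_real_subgradient:
  fixes f :: "real \<Rightarrow> real"
  assumes "convex_on UNIV f"
  shows "\<exists>c. \<forall>y. f x + c * (y - x) \<le> f y"
  using convex_le_Inf_differential[OF assms, of x] by auto

text \<open>One coordinate is eliminated at a time: minimising over it after subtracting the
  one-dimensional subgradient leaves a convex function of the remaining coordinates.\<close>
lemma coord_convex_subgradient:
  assumes "coord_convex \<Phi>"
  shows "\<exists>c. \<forall>z. (\<forall>i\<ge>N. z i = a i) \<longrightarrow> \<Phi> a + (\<Sum>i<N. c i * (z i - a i)) \<le> \<Phi> z"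
  using assms
proof (induction N arbitrary: \<Phi>)
  case 0
  have "z = a" if "\<forall>i\<ge>0. z i = a i" for z using that by auto
  thus ?case by auto
next
  case (Suc N)
  have "convex_on UNIV (\<lambda>s. \<Phi> (a(N := s)))"
  proof (intro convex_onI)
    fix t x y :: real assume t: "0 < t" "t < 1"
    have eq: "(\<lambda>i. (1 - t) * (a(N := x)) i + t * (a(N := y)) i) = a(N := (1 - t) *\<^sub>R x + t *\<^sub>R y)"
      by (auto simp: algebra_simps)
    show "\<Phi> (a(N := (1 - t) *\<^sub>R x + t *\<^sub>R y)) \<le> (1 - t) * \<Phi> (a(N := x)) + t * \<Phi> (a(N := y))"
      by (rule coord_convexD[OF Suc.prems, of t "a(N := x)" "a(N := y)", unfolded eq]) (use t in auto)
  qed auto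
  then obtain cN where cN: "\<And>s. \<Phi> a + cN * (s - a N) \<le> \<Phi> (a(N := s))"
    using convex_real_subgradient[of "\<lambda>s. \<Phi> (a(N := s))" "a N"] by auto
  \<comment> \<open>After the slope \<open>cN\<close> is subtracted, the choice
    \<open>s = a N\<close> is a minimizer for \<open>z = a\<close>, so that the partial minimum
    \<open>\<Psi>\<close> agrees with \<open>\<Phi>\<close> at \<open>a\<close>.\<close>
  define F where "F z s = \<Phi> (z(N := s)) - cN * (s - a N)" for z s
  define \<Psi> where "\<Psi> z = (INF s. F z s)" for z
  have Fconv: "F (\<lambda>i. (1 - t) * u i + t * v i) ((1 - t) * s + t * s') \<le> (1 - t) * F u s + t * F v s'"
    if "0 \<le> t" "t \<le> 1" for t u v s s'
  proof -
    have eq: "(\<lambda>i. (1 - t) * u i + t * v i)(N := (1 - t) * s + t * s')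
        = (\<lambda>i. (1 - t) * (u(N := s)) i + t * (v(N := s')) i)" by auto
    have "\<Phi> ((\<lambda>i. (1 - t) * u i + t * v i)(N := (1 - t) * s + t * s'))
        \<le> (1 - t) * \<Phi> (u(N := s)) + t * \<Phi> (v(N := s'))"
      unfolding eq by (rule coord_convexD[OF Suc.prems that])
    thus ?thesis unfolding F_def by (simp add: algebra_simps del: fun_upd_apply)
  qed
  have bdd: "bdd_below (range (F z))" for z
  proof
    fix y assume "y \<in> range (F z)"
    then obtain s where y: "y = F z s" by auto
    \<comment> \<open>Reflecting \<open>z\<close> in \<open>a\<close> makes \<open>a\<close> the
      midpoint; convexity then bounds the value at \<open>z\<close> from below by values that do not
      involve \<open>s\<close>.\<close>
    let ?w = "\<lambda>i. 2 * a i - z i"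
    have mid: "(\<lambda>i. (1 - 1/2) * z i + 1/2 * ?w i) = a" by (auto simp: field_simps)
    have "F a ((1 - 1/2) * s + 1/2 * a N) \<le> (1 - 1/2) * F z s + 1/2 * F ?w (a N)"
      using Fconv[of "1/2" z ?w s "a N"] unfolding mid by simp
    moreover have "\<Phi> a \<le> F a ((1 - 1/2) * s + 1/2 * a N)"
      using cN[of "(1 - 1/2) * s + 1/2 * a N"] by (simp add: F_def)
    ultimately show "2 * \<Phi> a - F ?w (a N) \<le> y" unfolding y by simp
  qed
  have \<Psi>_le: "\<Psi> z \<le> F z s" for z s
    unfolding \<Psi>_def by (rule cINF_lower[OF bdd]) simp
  have \<Psi>_a: "\<Psi> a = \<Phi> a"
  proof (rule antisym)
    show "\<Psi> a \<le> \<Phi> a" using \<Psi>_le[of a "a N"] by (simp add: F_def)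
    show "\<Phi> a \<le> \<Psi> a" unfolding \<Psi>_def
    proof (rule cINF_greatest)
      fix s show "\<Phi> a \<le> F a s" using cN[of s] by (simp add: F_def)
    qed simp
  qed
  have "coord_convex \<Psi>"
    unfolding coord_convex_def
  proof (intro allI impI)
    fix u v and t :: real assume t: "0 \<le> t \<and> t \<le> 1"
    show "\<Psi> (\<lambda>i. (1 - t) * u i + t * v i) \<le> (1 - t) * \<Psi> u + t * \<Psi> v"
    \<comment> \<open>The infimum defining \<open>\<Psi>\<close> need not be attained, hence points
      that are optimal up to \<open>e\<close>.\<close>
    proof (rule field_le_epsilon)
      fix e :: real assume e: "0 < e"
      have "\<exists>s. F z s < \<Psi> z + e" for z
        using cInf_lessD[of "range (F z)" "\<Psi> z + e"] e unfolding \<Psi>_def by auto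
      then obtain s s' where s: "F u s \<le> \<Psi> u + e" "F v s' \<le> \<Psi> v + e" by (meson less_imp_le)
      have "\<Psi> (\<lambda>i. (1 - t) * u i + t * v i) \<le> (1 - t) * F u s + t * F v s'"
        using \<Psi>_le Fconv t by (meson order_trans)
      also have "\<dots> \<le> (1 - t) * (\<Psi> u + e) + t * (\<Psi> v + e)"
        using s t by (intro add_mono mult_left_mono) auto
      finally show "\<Psi> (\<lambda>i. (1 - t) * u i + t * v i) \<le> (1 - t) * \<Psi> u + t * \<Psi> v + e"
        by (simp add: algebra_simps)
    qed
  qed
  from Suc.IH[OF this] obtain c where
    c: "\<And>z. (\<forall>i\<ge>N. z i = a i) \<Longrightarrow> \<Psi> a + (\<Sum>i<N. c i * (z i - a i)) \<le> \<Psi> z" by blast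
  show ?case
  proof (intro exI[of _ "c(N := cN)"] allI impI)
    fix z assume z: "\<forall>i\<ge>Suc N. z i = a i"
    \<comment> \<open>Resetting coordinate \<open>N\<close> to \<open>a N\<close> meets the premise
      on \<open>z\<close> and leaves \<open>\<Psi>\<close> unchanged, because \<open>\<Psi>\<close>
      minimizes over that coordinate.\<close>
    have "\<Psi> a + (\<Sum>i<N. c i * ((z(N := a N)) i - a i)) \<le> \<Psi> (z(N := a N))"
      using z by (intro c) (auto simp: Suc_le_eq)
    also have "\<Psi> (z(N := a N)) = \<Psi> z" by (simp add: \<Psi>_def F_def)
    also have "\<dots> \<le> F z (z N)" by (rule \<Psi>_le)
    finally show "\<Phi> a + (\<Sum>i<Suc N. (c(N := cN)) i * (z i - a i)) \<le> \<Phi> z"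
      by (simp add: \<Psi>_a F_def)
  qed
qed

text \<open>Exchange argument with the threshold \<open>a (card S - 1)\<close>: the indices of
  \<open>S\<close> outside the initial segment have values at most this, those of the segment
  outside \<open>S\<close> have values at least this, and there are equally many of both.\<close>

lemma sum_le_sum_initial:
  fixes a :: "nat \<Rightarrow> real"
  assumes a: "antimono_on {..<N} a" and S: "S \<subseteq> {..<N}"
  shows "sum a S \<le> sum a {..<card S}"
proof (cases "S = {}")
  case False
  let ?k = "card S" and ?T = "{..<card S}"
  have fin: "finite S" using S finite_subset by blast
  have k: "0 < ?k" "?k \<le> N" using False fin card_mono[OF _ S] by (auto simp: card_gt_0_iff)
  have le: "a j \<le> a i" if "i \<le> j" "j < N" for i j
    using monotone_onD[OF a, of i j] that by auto
  have "card (S - ?T) = card (?T - S)"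
    using card_Diff_subset_Int[of S ?T] card_Diff_subset_Int[of ?T S] fin by (simp add: Int_commute)
  moreover have "sum a (S - ?T) \<le> of_nat (card (S - ?T)) * a (?k - 1)"
    using S k by (intro sum_bounded_above le) auto
  moreover have "of_nat (card (?T - S)) * a (?k - 1) \<le> sum a (?T - S)"
    using S k by (intro sum_bounded_below le) auto
  ultimately have "sum a (S - ?T) \<le> sum a (?T - S)" by simp
  moreover have "sum a S = sum a (S - ?T) + sum a (S \<inter> ?T)" "sum a ?T = sum a (?T - S) + sum a (S \<inter> ?T)"
    using sum.Int_Diff[OF fin, of a ?T] sum.Int_Diff[of ?T a S] by (auto simp: Int_commute)
  ultimately show ?thesis by simp
qed simp

text \<open>Summation by parts, arranged as an induction: replacing \<open>e n\<close> by the
  smaller \<open>e (Suc n)\<close> in front of a nonnegative partial sum only lowers the bound. The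
  total sum 0 makes the last bound vanish.\<close>

lemma abel_sum_nonneg:
  fixes e d :: "nat \<Rightarrow> real"
  assumes e: "antimono_on {..<N} e" and d: "\<And>k. k < N \<Longrightarrow> 0 \<le> sum d {..<k}" "sum d {..<N} = 0"
  shows "0 \<le> (\<Sum>j<N. e j * d j)"
proof (cases N)
  case (Suc M)
  have "e n * sum d {..n} \<le> (\<Sum>j\<le>n. e j * d j)" if "n < N" for n
    using that
  proof (induction n)
    case (Suc n)
    have "e (Suc n) \<le> e n" using monotone_onD[OF e, of n "Suc n"] Suc.prems by auto
    hence "e (Suc n) * sum d {..n} \<le> e n * sum d {..n}"
      using d(1)[of "Suc n"] Suc.prems by (intro mult_right_mono) (auto simp: lessThan_Suc_atMost)
    also have "\<dots> \<le> (\<Sum>j\<le>n. e j * d j)" using Suc by simp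
    finally show ?case by (simp add: distrib_left)
  qed simp
  from this[of M] show ?thesis using Suc d(2) by (simp add: lessThan_Suc_atMost)
qed simp

lemma exists_sorting_permutation:
  fixes c :: "nat \<Rightarrow> real"
  shows "\<exists>\<pi>. \<pi> permutes {..<N} \<and> antimono_on {..<N} (c \<circ> \<pi>)"
proof -
  let ?ys = "map c [0..<N]"
  have "mset (rev (sort ?ys)) = mset ?ys" by simp
  then obtain \<pi> where \<pi>: "\<pi> permutes {..<length ?ys}" "permute_list \<pi> ?ys = rev (sort ?ys)"
    by (rule mset_eq_permutation)
  have nth: "rev (sort ?ys) ! i = c (\<pi> i)" if "i < N" for i
  proof -
    have "\<pi> i < N" using permutes_in_image[OF \<pi>(1), of i] that by simp
    thus ?thesis using permute_list_nth[OF \<pi>(1), of i] that unfolding \<pi>(2) by simp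
  qed
  have "antimono_on {..<N} (c \<circ> \<pi>)"
  proof (rule monotone_onI)
    fix i j assume ij: "i \<in> {..<N}" "j \<in> {..<N}" "i \<le> j"
    have "sort ?ys ! (N - Suc j) \<le> sort ?ys ! (N - Suc i)"
      using ij by (intro sorted_nth_mono) auto
    thus "(c \<circ> \<pi>) j \<le> (c \<circ> \<pi>) i" using ij nth by (simp add: rev_nth flip: nth)
  qed
  thus ?thesis using \<pi>(1) by auto
qed

text \<open>Combines Schur convexity with Jensen's inequality: the subgradient of \<open>\<Phi>\<close> at \<open>a\<close>, permuted so
  that its coefficients decrease, gives an affine minorant of \<open>\<Phi> \<circ> L\<close>.\<close>
lemma majorized_jensen_minorant:
  fixes \<Phi> :: "(nat \<Rightarrow> real) \<Rightarrow> real" and L :: "'a \<Rightarrow> nat \<Rightarrow> real"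
  assumes "prob_space M" and conv: "coord_convex \<Phi>"
    and sym: "\<And>u \<pi>. \<pi> permutes {..<N} \<Longrightarrow> \<Phi> (u \<circ> \<pi>) = \<Phi> u"
    and ext: "\<And>u v. (\<And>i. i < N \<Longrightarrow> u i = v i) \<Longrightarrow> \<Phi> u = \<Phi> v"
    and L: "\<And>i. i < N \<Longrightarrow> integrable M (\<lambda>\<tau>. L \<tau> i)"
    and a: "antimono_on {..<N} a"
    and maj: "\<And>k. k < N \<Longrightarrow> sum a {..<k} \<le> (\<Sum>i<k. \<integral>\<tau>. L \<tau> i \<partial>M)"
    and eq: "sum a {..<N} = (\<Sum>i<N. \<integral>\<tau>. L \<tau> i \<partial>M)"
  shows "\<exists>l. integrable M l \<and> (\<forall>\<tau>. l \<tau> \<le> \<Phi> (L \<tau>)) \<and> \<Phi> a \<le> (\<integral>\<tau>. l \<tau> \<partial>M)"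
proof -
  interpret prob_space M by fact
  obtain c where c: "\<And>z. (\<forall>i\<ge>N. z i = a i) \<Longrightarrow> \<Phi> a + (\<Sum>i<N. c i * (z i - a i)) \<le> \<Phi> z"
    using coord_convex_subgradient[OF conv, of N a] by blast
  obtain \<pi> where \<pi>: "\<pi> permutes {..<N}" and anti: "antimono_on {..<N} (c \<circ> \<pi>)"
    using exists_sorting_permutation by blast
  define l where "l \<tau> = \<Phi> a + (\<Sum>j<N. c (\<pi> j) * (L \<tau> j - a (\<pi> j)))" for \<tau>
  define b where "b j = (\<integral>\<tau>. L \<tau> j \<partial>M)" for j
  have "l \<tau> \<le> \<Phi> (L \<tau>)" for \<tau>
  proof -
    \<comment> \<open>The coordinates of \<open>L \<tau>\<close> in permuted order, which symmetry
      of \<open>\<Phi>\<close> undoes; beyond \<open>N\<close> the values of \<open>a\<close> are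
      used, as the subgradient inequality requires.\<close>
    let ?z = "\<lambda>i. if i < N then L \<tau> (inv_into UNIV \<pi> i) else a i"
    have "(\<Sum>i<N. c i * (?z i - a i)) = (\<Sum>j<N. c (\<pi> j) * (?z (\<pi> j) - a (\<pi> j)))"
      by (rule sum.permute[OF \<pi>, unfolded o_def])
    also have "\<dots> = (\<Sum>j<N. c (\<pi> j) * (L \<tau> j - a (\<pi> j)))"
      using permutes_in_image[OF \<pi>] by (intro sum.cong refl) (auto simp: permutes_inverses(2)[OF \<pi>])
    finally have "l \<tau> \<le> \<Phi> ?z" using c[of ?z] by (simp add: l_def)
    also have "\<Phi> ?z = \<Phi> (L \<tau> \<circ> inv_into UNIV \<pi>)" by (rule ext) simp
    also have "\<dots> = \<Phi> (L \<tau>)" by (rule sym[OF permutes_inv[OF \<pi>]])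
    finally show ?thesis .
  qed
  moreover have "integrable M l" unfolding l_def
    by (intro Bochner_Integration.integrable_add Bochner_Integration.integrable_sum
        integrable_mult_right Bochner_Integration.integrable_diff) (auto intro: L)
  moreover have "\<Phi> a \<le> (\<integral>\<tau>. l \<tau> \<partial>M)"
  proof -
    define X where "X j \<tau> = c (\<pi> j) * (L \<tau> j - a (\<pi> j))" for j \<tau>
    have int: "integrable M (X j)" "(\<integral>\<tau>. X j \<tau> \<partial>M) = c (\<pi> j) * (b j - a (\<pi> j))" if "j < N" for j
      using L[OF that] unfolding X_def by (simp_all add: prob_space b_def)
    have "(\<integral>\<tau>. l \<tau> \<partial>M) = (\<integral>\<tau>. \<Phi> a + (\<Sum>j<N. X j \<tau>) \<partial>M)" unfolding l_def X_def ..
    also have "\<dots> = \<Phi> a + (\<integral>\<tau>. (\<Sum>j<N. X j \<tau>) \<partial>M)"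
      using int by (subst Bochner_Integration.integral_add) (auto simp: prob_space)
    also have "(\<integral>\<tau>. (\<Sum>j<N. X j \<tau>) \<partial>M) = (\<Sum>j<N. c (\<pi> j) * (b j - a (\<pi> j)))"
      using int by (subst Bochner_Integration.integral_sum) auto
    finally have "(\<integral>\<tau>. l \<tau> \<partial>M) = \<Phi> a + (\<Sum>j<N. c (\<pi> j) * (b j - a (\<pi> j)))" .
    moreover have "0 \<le> (\<Sum>j<N. (c \<circ> \<pi>) j * (b j - a (\<pi> j)))"
    proof (rule abel_sum_nonneg[OF anti])
      have inj: "inj_on \<pi> X" for X using permutes_inj[OF \<pi>] by (simp add: inj_on_def)
      fix k assume k: "k < N"
      \<comment> \<open>Since \<open>a\<close> decreases, any \<open>k\<close> of its entries sum to
        at most the first \<open>k\<close>, which the majorization compares with the means.\<close>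
      have "(\<Sum>j<k. a (\<pi> j)) = sum a (\<pi> ` {..<k})" by (simp add: sum.reindex[OF inj])
      also have "\<dots> \<le> sum a {..<card (\<pi> ` {..<k})}"
        using image_mono[of "{..<k}" "{..<N}" \<pi>] k unfolding permutes_image[OF \<pi>]
        by (intro sum_le_sum_initial[OF a]) (simp add: lessThan_subset_iff)
      also have "card (\<pi> ` {..<k}) = k" by (simp add: card_image[OF inj])
      finally show "0 \<le> (\<Sum>j<k. b j - a (\<pi> j))"
        using maj[OF k] by (simp add: sum_subtractf b_def)
    next
      have "(\<Sum>j<N. a (\<pi> j)) = sum a {..<N}" using sum.permute[OF \<pi>, of a] by (simp add: o_def)
      thus "(\<Sum>j<N. b j - a (\<pi> j)) = 0" using eq by (simp add: sum_subtractf b_def)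
    qed
    ultimately show ?thesis by (simp add: o_def)
  qed
  ultimately show ?thesis by blast
qed

section \<open>Symmetric gauge functions\<close>

abbreviation vgauge :: "nat \<Rightarrow> (real list \<Rightarrow> real) \<Rightarrow> (nat \<Rightarrow> real) \<Rightarrow> real" where
  "vgauge N \<rho> u \<equiv> \<rho> (map u [0..<N])"

context
  fixes N :: nat and \<rho> :: "real list \<Rightarrow> real"
  assumes \<rho>: "sym_gauge N \<rho>"
begin

lemma gauge_eq_0_iff: "vgauge N \<rho> u = 0 \<longleftrightarrow> (\<forall>i<N. u i = 0)"
  using \<rho> by (simp add: sym_gauge_def)

lemma gauge_scale: "vgauge N \<rho> (\<lambda>i. c * u i) = \<bar>c\<bar> * vgauge N \<rho> u"
proof -
  have "\<rho> (map (\<lambda>t. c * t) (map u [0..<N])) = \<bar>c\<bar> * vgauge N \<rho> u"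
    using \<rho> unfolding sym_gauge_def by (metis diff_zero length_map length_upt)
  thus ?thesis by (simp add: o_def)
qed

lemma gauge_triangle: "vgauge N \<rho> (\<lambda>i. u i + v i) \<le> vgauge N \<rho> u + vgauge N \<rho> v"
proof -
  have "\<rho> (map2 (+) (map u [0..<N]) (map v [0..<N])) \<le> vgauge N \<rho> u + vgauge N \<rho> v"
    using \<rho> unfolding sym_gauge_def by (metis diff_zero length_map length_upt)
  moreover have "map2 (+) (map u [0..<N]) (map v [0..<N]) = map (\<lambda>i. u i + v i) [0..<N]"
    by (rule nth_equalityI) auto
  ultimately show ?thesis by simp
qed

lemma gauge_abs: "vgauge N \<rho> (\<lambda>i. \<bar>u i\<bar>) = vgauge N \<rho> u"
proof -
  have "\<rho> (map abs (map u [0..<N])) = vgauge N \<rho> u"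
    using \<rho> unfolding sym_gauge_def by (metis diff_zero length_map length_upt)
  thus ?thesis by (simp add: o_def)
qed

lemma gauge_mset: "length xs = N \<Longrightarrow> mset xs = mset ys \<Longrightarrow> \<rho> xs = \<rho> ys"
  using \<rho> unfolding sym_gauge_def by metis

lemma gauge_permute:
  assumes "\<pi> permutes {..<N}"
  shows "vgauge N \<rho> (u \<circ> \<pi>) = vgauge N \<rho> u"
proof (rule gauge_mset)
  have "mset (map (u \<circ> \<pi>) [0..<N]) = image_mset u (image_mset \<pi> (mset_set {..<N}))"
    by (simp add: image_mset.compositionality atLeast0LessThan)
  also have "image_mset \<pi> (mset_set {..<N}) = mset_set {..<N}"
    using permutes_inj[OF assms] permutes_image[OF assms]
    by (subst image_mset_mset_set) (auto simp: inj_on_def)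
  finally show "mset (map (u \<circ> \<pi>) [0..<N]) = mset (map u [0..<N])"
    by (simp add: atLeast0LessThan o_def)
qed simp

text \<open>The triangle inequality for \<open>u\<close> and its negative, both of the same gauge,
  gives that twice the gauge is at least 0.\<close>

lemma gauge_nonneg: "0 \<le> vgauge N \<rho> u"
proof -
  have "vgauge N \<rho> (\<lambda>i. u i + - 1 * u i) \<le> vgauge N \<rho> u + vgauge N \<rho> (\<lambda>i. - 1 * u i)" by (rule gauge_triangle)
  moreover have "vgauge N \<rho> (\<lambda>i. u i + - 1 * u i) = 0" by (subst gauge_eq_0_iff) simp
  ultimately show ?thesis by (simp only: gauge_scale)
qed

lemma gauge_convex:
  assumes "0 \<le> s" "s \<le> 1"
  shows "vgauge N \<rho> (\<lambda>i. (1 - s) * u i + s * v i) \<le> (1 - s) * vgauge N \<rho> u + s * vgauge N \<rho> v"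
  using gauge_triangle[of "\<lambda>i. (1 - s) * u i" "\<lambda>i. s * v i"] assms by (simp add: gauge_scale)

text \<open>Changing the sign of one coordinate preserves the gauge, and a vector with that
  coordinate shrunk is a convex combination of the two signed versions.\<close>

lemma gauge_shrink_coord:
  assumes "\<bar>x\<bar> \<le> \<bar>u j\<bar>"
  shows "vgauge N \<rho> (u(j := x)) \<le> vgauge N \<rho> u"
proof (cases "u j = 0")
  case True
  hence "u(j := x) = u" using assms by auto
  thus ?thesis by simp
next
  case False
  define r where "r = x / u j"
  have r: "- 1 \<le> r" "r \<le> 1" and x: "x = r * u j"
    using assms False by (auto simp: r_def field_simps abs_le_iff abs_if split: if_splits)
  let ?v = "u(j := - u j)" and ?s = "(1 - r) / 2"
  have v: "vgauge N \<rho> ?v = vgauge N \<rho> u"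
  proof -
    have "(\<lambda>i. \<bar>?v i\<bar>) = (\<lambda>i. \<bar>u i\<bar>)" by auto
    thus ?thesis using gauge_abs[of ?v] gauge_abs[of u] by simp
  qed
  have "u(j := x) = (\<lambda>i. (1 - ?s) * u i + ?s * ?v i)"
    by (auto simp: x field_simps)
  moreover have "vgauge N \<rho> (\<lambda>i. (1 - ?s) * u i + ?s * ?v i) \<le> (1 - ?s) * vgauge N \<rho> u + ?s * vgauge N \<rho> ?v"
    using r by (intro gauge_convex) auto
  ultimately show ?thesis unfolding v by (simp add: algebra_simps)
qed

lemma gauge_mono:
  assumes "\<And>i. i < N \<Longrightarrow> \<bar>u i\<bar> \<le> \<bar>v i\<bar>"
  shows "vgauge N \<rho> u \<le> vgauge N \<rho> v"
proof -
  have "vgauge N \<rho> (\<lambda>i. if i < k then u i else v i) \<le> vgauge N \<rho> v" if "k \<le> N" for k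
    using that
  proof (induction k)
    case (Suc k)
    let ?w = "\<lambda>i. if i < k then u i else v i"
    have "(\<lambda>i. if i < Suc k then u i else v i) = ?w(k := u k)" by (auto simp: less_Suc_eq)
    moreover have "vgauge N \<rho> (?w(k := u k)) \<le> vgauge N \<rho> ?w"
      using assms[of k] Suc.prems by (intro gauge_shrink_coord) auto
    ultimately show ?case using Suc by simp
  qed simp
  moreover have "vgauge N \<rho> (\<lambda>i. if i < N then u i else v i) = vgauge N \<rho> u"
    by (intro arg_cong[where f = \<rho>] map_cong) auto
  ultimately show ?thesis by (metis order_refl)
qed

text \<open>Convexity of \<open>\<phi>\<close> gives an inequality in each coordinate, and
  nonnegativity lets monotonicity in the absolute values apply to it.\<close>

lemma coord_convex_gauge_comp:
  assumes g: "convex_on UNIV \<phi>" and nn: "\<And>x. 0 \<le> \<phi> x"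
  shows "coord_convex (\<lambda>u. vgauge N \<rho> (\<lambda>i. \<phi> (u i)))"
  unfolding coord_convex_def
proof (intro allI impI)
  fix u v and t :: real assume t: "0 \<le> t \<and> t \<le> 1"
  have "vgauge N \<rho> (\<lambda>i. \<phi> ((1 - t) * u i + t * v i)) \<le> vgauge N \<rho> (\<lambda>i. (1 - t) * \<phi> (u i) + t * \<phi> (v i))"
  proof (rule gauge_mono)
    fix i
    have "\<phi> ((1 - t) * u i + t * v i) \<le> (1 - t) * \<phi> (u i) + t * \<phi> (v i)"
      using convex_onD[OF g, of t "u i" "v i"] t by simp
    thus "\<bar>\<phi> ((1 - t) * u i + t * v i)\<bar> \<le> \<bar>(1 - t) * \<phi> (u i) + t * \<phi> (v i)\<bar>" using nn by simp
  qed
  also have "\<dots> \<le> (1 - t) * vgauge N \<rho> (\<lambda>i. \<phi> (u i)) + t * vgauge N \<rho> (\<lambda>i. \<phi> (v i))"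
    using t by (intro gauge_convex) auto
  finally show "vgauge N \<rho> (\<lambda>i. \<phi> ((1 - t) * u i + t * v i))
      \<le> (1 - t) * vgauge N \<rho> (\<lambda>i. \<phi> (u i)) + t * vgauge N \<rho> (\<lambda>i. \<phi> (v i))" .
qed

lemma gauge_exp_pos:
  assumes "0 < N"
  shows "0 < vgauge N \<rho> (\<lambda>i. exp (u i))"
proof -
  have "vgauge N \<rho> (\<lambda>i. exp (u i)) \<noteq> 0" unfolding gauge_eq_0_iff using assms by (simp add: exI[of _ 0])
  thus ?thesis using gauge_nonneg[of "\<lambda>i. exp (u i)"] by linarith
qed

text \<open>Divide the two exponential vectors by their gauges \<open>exp \<alpha>\<close> and
  \<open>exp \<beta>\<close>. Convexity of \<open>exp\<close> then bounds their weighted geometric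
  mean by a weighted arithmetic mean of two vectors of gauge 1, so its gauge is at most 1; undoing
  the scaling yields the logarithmic inequality.\<close>

lemma coord_convex_ln_gauge_exp_comp:
  assumes g: "convex_on UNIV \<phi>" and N: "0 < N"
  shows "coord_convex (\<lambda>u. ln (vgauge N \<rho> (\<lambda>i. exp (\<phi> (u i)))))"
  unfolding coord_convex_def
proof (intro allI impI)
  fix u v and t :: real assume t: "0 \<le> t \<and> t \<le> 1"
  let ?R = "\<lambda>u. vgauge N \<rho> (\<lambda>i. exp (\<phi> (u i)))"
  define \<alpha> \<beta> where "\<alpha> = ln (?R u)" and "\<beta> = ln (?R v)"
  let ?c = "(1 - t) * \<alpha> + t * \<beta>" and ?w = "\<lambda>i. (1 - t) * u i + t * v i"
  have ab: "?R u = exp \<alpha>" "?R v = exp \<beta>"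
    unfolding \<alpha>_def \<beta>_def using gauge_exp_pos[OF N] by simp_all
  have "exp (- ?c) * ?R ?w = vgauge N \<rho> (\<lambda>i. exp (- ?c) * exp (\<phi> (?w i)))"
    by (simp add: gauge_scale)
  also have "\<dots> \<le> vgauge N \<rho> (\<lambda>i. (1 - t) * (exp (- \<alpha>) * exp (\<phi> (u i))) + t * (exp (- \<beta>) * exp (\<phi> (v i))))"
  proof (rule gauge_mono)
    fix i
    have "\<phi> (?w i) \<le> (1 - t) * \<phi> (u i) + t * \<phi> (v i)"
      using convex_onD[OF g, of t "u i" "v i"] t by simp
    hence "exp (- ?c) * exp (\<phi> (?w i)) \<le> exp ((1 - t) * (\<phi> (u i) - \<alpha>) + t * (\<phi> (v i) - \<beta>))"
      by (simp add: algebra_simps flip: exp_add)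
    also have "\<dots> \<le> (1 - t) * exp (\<phi> (u i) - \<alpha>) + t * exp (\<phi> (v i) - \<beta>)"
      using convex_onD[OF exp_convex, of t "\<phi> (u i) - \<alpha>" "\<phi> (v i) - \<beta>"] t by simp
    also have "\<dots> = (1 - t) * (exp (- \<alpha>) * exp (\<phi> (u i))) + t * (exp (- \<beta>) * exp (\<phi> (v i)))"
      by (simp add: exp_diff exp_minus field_simps)
    finally show "\<bar>exp (- ?c) * exp (\<phi> (?w i))\<bar>
        \<le> \<bar>(1 - t) * (exp (- \<alpha>) * exp (\<phi> (u i))) + t * (exp (- \<beta>) * exp (\<phi> (v i)))\<bar>" by simp
  qed
  also have "\<dots> \<le> (1 - t) * vgauge N \<rho> (\<lambda>i. exp (- \<alpha>) * exp (\<phi> (u i))) + t * vgauge N \<rho> (\<lambda>i. exp (- \<beta>) * exp (\<phi> (v i)))"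
    using t by (intro gauge_convex) auto
  also have "\<dots> = 1" unfolding gauge_scale ab by (simp add: exp_minus)
  finally have "exp ?c * (exp (- ?c) * ?R ?w) \<le> exp ?c * 1" by (intro mult_left_mono) auto
  moreover have "exp ?c * (exp (- ?c) * ?R ?w) = ?R ?w"
    unfolding mult.assoc[symmetric] exp_add[symmetric] right_minus by simp
  ultimately have "?R ?w \<le> exp ?c" by linarith
  thus "ln (?R ?w) \<le> (1 - t) * ln (?R u) + t * ln (?R v)"
    using gauge_exp_pos[OF N, of "\<lambda>i. \<phi> (?w i)"] unfolding \<alpha>_def[symmetric] \<beta>_def[symmetric]
    by (metis ln_exp ln_le_cancel_iff exp_gt_zero)
qed

end

section \<open>Ky Fan norms\<close>

definition ky_fan :: "nat \<Rightarrow> real list \<Rightarrow> real" where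
  "ky_fan k xs = Max ((\<lambda>S. \<Sum>i\<in>S. \<bar>xs ! i\<bar>) ` {S. S \<subseteq> {..<length xs} \<and> card S = k})"

lemma finite_ky_fan_sets: "finite {S. S \<subseteq> {..<n :: nat} \<and> card S = k}"
  by (rule finite_subset[of _ "Pow {..<n}"]) auto

lemma ky_fan_ge: "S \<subseteq> {..<length xs} \<Longrightarrow> card S = k \<Longrightarrow> (\<Sum>i\<in>S. \<bar>xs ! i\<bar>) \<le> ky_fan k xs"
  unfolding ky_fan_def by (intro Max_ge finite_imageI finite_ky_fan_sets) auto

lemma ky_fan_attained:
  assumes "k \<le> length xs"
  shows "\<exists>S. S \<subseteq> {..<length xs} \<and> card S = k \<and> ky_fan k xs = (\<Sum>i\<in>S. \<bar>xs ! i\<bar>)"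
proof -
  let ?F = "{S. S \<subseteq> {..<length xs} \<and> card S = k}"
  have "{..<k} \<in> ?F" using assms by auto
  hence "?F \<noteq> {}" by blast
  hence "ky_fan k xs \<in> (\<lambda>S. \<Sum>i\<in>S. \<bar>xs ! i\<bar>) ` ?F"
    unfolding ky_fan_def by (intro Max_in finite_imageI finite_ky_fan_sets) auto
  thus ?thesis by auto
qed

lemma ky_fan_mset_le:
  assumes k: "k \<le> length xs" and m: "mset xs = mset ys"
  shows "ky_fan k xs \<le> ky_fan k ys"
proof -
  obtain \<pi> where \<pi>: "\<pi> permutes {..<length ys}" "permute_list \<pi> ys = xs"
    using mset_eq_permutation[OF m] .
  have len: "length xs = length ys" using m mset_eq_length by blast
  obtain S where S: "S \<subseteq> {..<length xs}" "card S = k" "ky_fan k xs = (\<Sum>i\<in>S. \<bar>xs ! i\<bar>)"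
    using ky_fan_attained[OF k] by blast
  have inj: "inj_on \<pi> S" using permutes_inj[OF \<pi>(1)] by (rule inj_on_subset) simp
  have "xs ! i = ys ! \<pi> i" if "i \<in> S" for i
    using permute_list_nth[OF \<pi>(1), of i] S(1) that len unfolding \<pi>(2) by auto
  hence "ky_fan k xs = (\<Sum>i\<in>\<pi> ` S. \<bar>ys ! i\<bar>)"
    unfolding S(3) by (simp add: sum.reindex[OF inj])
  also have "\<dots> \<le> ky_fan k ys"
  proof (rule ky_fan_ge)
    show "\<pi> ` S \<subseteq> {..<length ys}"
      using image_mono[OF S(1), of \<pi>] unfolding len permutes_image[OF \<pi>(1)] .
    show "card (\<pi> ` S) = k" using card_image[OF inj] S(2) by simp
  qed
  finally show ?thesis .
qed

text \<open>As a maximum over index sets of size \<open>k\<close>, the sum of the \<open>k\<close>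
  largest absolute values inherits homogeneity and the triangle inequality from the single sums. For
  definiteness, \<open>1 \<le> k\<close> lets every index be completed to such a set.\<close>

lemma sym_gauge_ky_fan:
  assumes k: "1 \<le> k" "k \<le> N"
  shows "sym_gauge N (ky_fan k)"
  unfolding sym_gauge_def
proof (intro conjI allI impI)
  fix x :: "real list" assume x: "length x = N"
  show "ky_fan k x = 0 \<longleftrightarrow> (\<forall>i<N. x ! i = 0)"
  proof
    assume 0: "ky_fan k x = 0"
    show "\<forall>i<N. x ! i = 0"
    proof (intro allI impI)
      fix i assume i: "i < N"
      obtain T where T: "T \<subseteq> {..<N} - {i}" "card T = k - 1"
      proof (rule obtain_subset_with_card_n[of "k - 1" "{..<N} - {i}"])
        show "k - 1 \<le> card ({..<N} - {i})" using k i by simp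
      qed
      have finT: "finite T" using T(1) by (rule finite_subset) simp
      have "i \<notin> T" using T by auto
      hence "\<bar>x ! i\<bar> \<le> (\<Sum>j\<in>insert i T. \<bar>x ! j\<bar>)" using finT by (simp add: sum_nonneg)
      also have "\<dots> \<le> ky_fan k x"
        using T i k x \<open>i \<notin> T\<close> finT by (intro ky_fan_ge) auto
      finally show "x ! i = 0" using 0 by simp
    qed
  next
    assume 0: "\<forall>i<N. x ! i = 0"
    obtain S where "S \<subseteq> {..<N}" "ky_fan k x = (\<Sum>i\<in>S. \<bar>x ! i\<bar>)"
      using ky_fan_attained[of k x] k x by auto
    thus "ky_fan k x = 0" using 0 by (auto intro!: sum.neutral)
  qed
next
  fix x :: "real list" and c :: real assume x: "length x = N"
  let ?F = "{S. S \<subseteq> {..<N} \<and> card S = k}"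
  have "{..<k} \<in> ?F" using k by auto
  hence ne: "(\<lambda>S. \<Sum>i\<in>S. \<bar>x ! i\<bar>) ` ?F \<noteq> {}" by blast
  have "mono (\<lambda>t. \<bar>c\<bar> * t)" by (auto intro!: monoI mult_left_mono)
  from mono_Max_commute[OF this finite_imageI[OF finite_ky_fan_sets] ne]
  have "\<bar>c\<bar> * ky_fan k x = Max ((\<lambda>S. \<bar>c\<bar> * (\<Sum>i\<in>S. \<bar>x ! i\<bar>)) ` ?F)"
    by (simp add: ky_fan_def x image_image)
  also have "(\<lambda>S. \<bar>c\<bar> * (\<Sum>i\<in>S. \<bar>x ! i\<bar>)) ` ?F = (\<lambda>S. \<Sum>i\<in>S. \<bar>map (\<lambda>t. c * t) x ! i\<bar>) ` ?F"
    using x by (intro image_cong refl) (auto simp: sum_distrib_left abs_mult intro!: sum.cong)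
  finally show "ky_fan k (map (\<lambda>t. c * t) x) = \<bar>c\<bar> * ky_fan k x"
    by (simp add: ky_fan_def x)
next
  fix x y :: "real list" assume x: "length x = N" and y: "length y = N"
  obtain S where S: "S \<subseteq> {..<N}" "card S = k" "ky_fan k (map2 (+) x y) = (\<Sum>i\<in>S. \<bar>map2 (+) x y ! i\<bar>)"
    using ky_fan_attained[of k "map2 (+) x y"] k x y by auto
  have "(\<Sum>i\<in>S. \<bar>map2 (+) x y ! i\<bar>) \<le> (\<Sum>i\<in>S. \<bar>x ! i\<bar> + \<bar>y ! i\<bar>)"
    using S(1) x y by (intro sum_mono) (auto intro!: abs_triangle_ineq)
  also have "\<dots> \<le> ky_fan k x + ky_fan k y"
    unfolding sum.distrib using S x y by (intro add_mono ky_fan_ge) auto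
  finally show "ky_fan k (map2 (+) x y) \<le> ky_fan k x + ky_fan k y" unfolding S(3) .
next
  fix x :: "real list" assume x: "length x = N"
  show "ky_fan k (map abs x) = ky_fan k x"
    unfolding ky_fan_def using x
    by (intro arg_cong[where f = Max] image_cong) (auto intro!: sum.cong)
next
  fix x y :: "real list" assume "length x = N" "mset x = mset y"
  thus "ky_fan k y = ky_fan k x"
    using ky_fan_mset_le[of k x y] ky_fan_mset_le[of k y x] k mset_eq_length[of x y] by force
qed

lemma gauge_ky_fan_antimono:
  assumes k: "k \<le> N" and u: "antimono_on {..<N} u" and nn: "\<And>i. i < N \<Longrightarrow> 0 \<le> u i"
  shows "vgauge N (ky_fan k) u = sum u {..<k}"
proof (rule antisym)
  have eq: "(\<Sum>i\<in>S. \<bar>map u [0..<N] ! i\<bar>) = sum u S" if "S \<subseteq> {..<N}" for S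
    using that nn by (intro sum.cong refl) auto
  show "sum u {..<k} \<le> vgauge N (ky_fan k) u"
    using ky_fan_ge[of "{..<k}" "map u [0..<N]" k] eq[of "{..<k}"] k by auto
  obtain S where "S \<subseteq> {..<N}" "card S = k" "vgauge N (ky_fan k) u = (\<Sum>i\<in>S. \<bar>map u [0..<N] ! i\<bar>)"
    using ky_fan_attained[of k "map u [0..<N]"] k by auto
  thus "vgauge N (ky_fan k) u \<le> sum u {..<k}"
    using sum_le_sum_initial[OF u, of S] eq[of S] by simp
qed

text \<open>For \<open>k = N\<close> there is one index set only, so the entries may come in any
  order; this serves negative powers of decreasing T-eigenvalues.\<close>

lemma gauge_ky_fan_full:
  assumes nn: "\<And>i. i < N \<Longrightarrow> 0 \<le> u i"
  shows "vgauge N (ky_fan N) u = sum u {..<N}"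
proof -
  obtain S where S: "S \<subseteq> {..<N}" "card S = N" "vgauge N (ky_fan N) u = (\<Sum>i\<in>S. \<bar>map u [0..<N] ! i\<bar>)"
    using ky_fan_attained[of N "map u [0..<N]"] by auto
  have "S = {..<N}" using S(1,2) by (intro card_subset_eq) auto
  thus ?thesis unfolding S(3) using nn by (intro sum.cong) auto
qed

section \<open>Norms of tensor functions and measurability of T-eigenvalues\<close>

abbreviation teig :: "nat \<Rightarrow> nat \<Rightarrow> (nat \<Rightarrow> real mat) \<Rightarrow> nat \<Rightarrow> real" where
  "teig m p C i \<equiv> teig_list m p C ! i"

lemma antimono_teig:
  assumes "tsym m p C"
  shows "antimono_on {..<m * p} (teig m p C)"
proof (rule monotone_onI)
  fix i j assume ij: "i \<in> {..<m * p}" "j \<in> {..<m * p}" "i \<le> j"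
  have "sorted_wrt (\<ge>) (teig_list m p C)" using sorted_teig_list[of m p C] by (simp add: sorted_wrt_rev)
  thus "teig m p C j \<le> teig m p C i"
    using ij length_teig_list[OF assms] sorted_wrt_nth_less[of "(\<ge>)" "teig_list m p C" i j]
    by (cases "i = j") auto
qed

lemma map_teig: "tsym m p C \<Longrightarrow> map (teig m p C) [0..<m * p] = teig_list m p C"
  using length_teig_list[of m p C] map_nth[of "teig_list m p C"] by simp

lemma set_teig_list: "tsym m p C \<Longrightarrow> set (teig_list m p C) = teig m p C ` {..<m * p}"
  using length_teig_list[of m p C] by (auto simp: set_conv_nth)

text \<open>Only permutation invariance is asked of \<open>\<rho>\<close>, so that the lemma also
  covers \<open>sum_list\<close>, the trace norm of the moment condition, which is no gauge on
  vectors with negative entries.\<close>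

lemma tnorm_tfun:
  assumes C: "tsym m p C" and \<rho>: "\<And>xs ys. length xs = m * p \<Longrightarrow> mset xs = mset ys \<Longrightarrow> \<rho> xs = \<rho> ys"
  shows "tnorm \<rho> m p (tfun m p h (cplx_tensor C)) = vgauge (m * p) \<rho> (\<lambda>i. \<bar>h (teig m p C i)\<bar>)"
proof -
  have "mset (tsval_list m p (tfun m p h (cplx_tensor C))) = mset (map (\<lambda>i. \<bar>h (teig m p C i)\<bar>) [0..<m * p])"
  proof -
    have "map (\<lambda>i. \<bar>h (teig m p C i)\<bar>) [0..<m * p] = map (\<lambda>x. \<bar>h x\<bar>) (map (teig m p C) [0..<m * p])"
      by simp
    also have "\<dots> = map (\<lambda>x. \<bar>h x\<bar>) (teig_list m p C)" unfolding map_teig[OF C] ..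
    finally show ?thesis by (simp only: mset_map mset_tsval_list_tfun[OF C])
  qed
  hence "\<rho> (map (\<lambda>i. \<bar>h (teig m p C i)\<bar>) [0..<m * p]) = \<rho> (tsval_list m p (tfun m p h (cplx_tensor C)))"
    by (intro \<rho>) simp_all
  thus ?thesis unfolding tnorm_def ..
qed

lemma fnorm_eq:
  assumes C: "tsym m p C" and pos: "\<And>i. i < m * p \<Longrightarrow> 0 < teig m p C i"
    and \<rho>: "sym_gauge (m * p) \<rho>"
  shows "fnorm \<rho> m p f C = ennreal (vgauge (m * p) \<rho> (\<lambda>i. f (teig m p C i)))"
proof -
  have "tnorm \<rho> m p (tfun m p (fext f) (cplx_tensor C)) = vgauge (m * p) \<rho> (\<lambda>i. \<bar>fext f (teig m p C i)\<bar>)"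
    by (rule tnorm_tfun[OF C gauge_mset[OF \<rho>]])
  also have "\<dots> = vgauge (m * p) \<rho> (\<lambda>i. fext f (teig m p C i))" by (rule gauge_abs[OF \<rho>])
  also have "\<dots> = vgauge (m * p) \<rho> (\<lambda>i. f (teig m p C i))"
    using pos by (intro arg_cong[where f = \<rho>] map_cong refl) (simp add: fext_def)
  finally show ?thesis using pos unfolding fnorm_def set_teig_list[OF C] by fastforce
qed

lemma flim0_neg_powr:
  assumes q: "0 < q"
  shows "flim0 (\<lambda>x. x powr (- q)) = \<infinity>"
proof -
  have "filterlim (\<lambda>x. q * - ln x) at_top (at_right (0::real))"
    using ln_at_0 by (intro filterlim_tendsto_pos_mult_at_top[OF tendsto_const q]) (simp add: filterlim_uminus_at_bot)
  hence "filterlim (\<lambda>x. exp (q * - ln x)) at_top (at_right (0::real))"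
    by (rule filterlim_compose[OF exp_at_top])
  moreover have "eventually (\<lambda>x::real. exp (q * - ln x) = x powr (- q)) (at_right 0)"
    unfolding eventually_at_right_field by (intro exI[of _ 1]) (auto simp: powr_def)
  ultimately have "filterlim (\<lambda>x::real. x powr (- q)) at_top (at_right 0)"
    by (rule filterlim_cong[THEN iffD1, OF refl refl, rotated])
  hence "((\<lambda>x. ereal (x powr (- q))) \<longlongrightarrow> \<infinity>) (at_right 0)"
    by (simp add: tendsto_PInfty_eq_at_top)
  thus ?thesis unfolding flim0_def by (intro tendsto_Lim) auto
qed

text \<open>Once the coordinates before \<open>j\<close> are measurable, subtracting their powers
  leaves the power sum from \<open>j\<close> on. Its root of order \<open>Suc n\<close> lies between
  \<open>x \<tau> j\<close> and \<open>N powr (1 / Suc n)\<close> times \<open>x \<tau> j\<close>,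
  and the factor tends to 1.\<close>

lemma measurable_from_power_sums:
  fixes x :: "'a \<Rightarrow> nat \<Rightarrow> real"
  assumes nn: "\<And>\<tau> i. i < N \<Longrightarrow> 0 \<le> x \<tau> i" and anti: "\<And>\<tau>. antimono_on {..<N} (x \<tau>)"
    and meas: "\<And>k. (\<lambda>\<tau>. \<Sum>i<N. x \<tau> i ^ k) \<in> borel_measurable M"
    and j: "j < N"
  shows "(\<lambda>\<tau>. x \<tau> j) \<in> borel_measurable M"
  using j
proof (induction j rule: less_induct)
  case (less j)
  define R where "R k \<tau> = (\<Sum>i<N. x \<tau> i ^ k) - (\<Sum>i<j. x \<tau> i ^ k)" for k \<tau>
  have R: "R k \<tau> = (\<Sum>i\<in>{j..<N}. x \<tau> i ^ k)" for k \<tau>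
    using less.prems sum.atLeastLessThan_concat[of 0 j N "\<lambda>i. x \<tau> i ^ k"]
    by (simp add: R_def atLeast0LessThan)
  have Rm: "R k \<in> borel_measurable M" for k
    unfolding R_def using less.IH less.prems
    by (intro borel_measurable_diff[OF meas[of k]] borel_measurable_sum borel_measurable_power) auto
  have pow: "(t ^ Suc n) powr (1 / Suc n) = t" if "0 \<le> t" for t :: real and n
  proof (cases "t = 0")
    case False
    hence "t ^ Suc n = t powr real (Suc n)" using that by (intro powr_realpow[symmetric]) simp
    thus ?thesis using that False by (simp only: powr_powr) simp
  qed simp
  have "(\<lambda>n. R (Suc n) \<tau> powr (1 / Suc n)) \<longlonglongrightarrow> x \<tau> j" for \<tau>
  proof (rule tendsto_sandwich)
    have xj: "0 \<le> x \<tau> j" using nn less.prems by simp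
    show "eventually (\<lambda>n. x \<tau> j \<le> R (Suc n) \<tau> powr (1 / Suc n)) sequentially"
    proof (intro always_eventually allI)
      fix n
      have "x \<tau> j ^ Suc n \<le> R (Suc n) \<tau>"
        unfolding R using less.prems nn by (intro member_le_sum) auto
      hence "(x \<tau> j ^ Suc n) powr (1 / Suc n) \<le> R (Suc n) \<tau> powr (1 / Suc n)"
        using xj by (intro powr_mono2) auto
      thus "x \<tau> j \<le> R (Suc n) \<tau> powr (1 / Suc n)" using pow[OF xj, of n] by simp
    qed
    show "eventually (\<lambda>n. R (Suc n) \<tau> powr (1 / Suc n) \<le> real N powr (1 / Suc n) * x \<tau> j) sequentially"
    proof (intro always_eventually allI)
      fix n
      have "R (Suc n) \<tau> \<le> (\<Sum>i\<in>{j..<N}. x \<tau> j ^ Suc n)"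
        unfolding R using nn monotone_onD[OF anti] less.prems by (intro sum_mono power_mono) auto
      also have "\<dots> \<le> real N * x \<tau> j ^ Suc n"
        using xj by (simp del: power_Suc) (intro mult_right_mono, auto)
      finally have "R (Suc n) \<tau> powr (1 / Suc n) \<le> (real N * x \<tau> j ^ Suc n) powr (1 / Suc n)"
        unfolding R using nn by (intro powr_mono2 sum_nonneg) auto
      also have "\<dots> = real N powr (1 / Suc n) * x \<tau> j"
        using xj pow[OF xj, of n] by (simp add: powr_mult del: power_Suc)
      finally show "R (Suc n) \<tau> powr (1 / Suc n) \<le> real N powr (1 / Suc n) * x \<tau> j" .
    qed
    have "(\<lambda>n. real N powr (1 / Suc n)) \<longlonglongrightarrow> real N powr 0"
      using less.prems LIMSEQ_inverse_real_of_nat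
      by (intro tendsto_powr tendsto_const) (auto simp: inverse_eq_divide)
    from tendsto_mult_right[OF this, of "x \<tau> j"]
    show "(\<lambda>n. real N powr (1 / Suc n) * x \<tau> j) \<longlonglongrightarrow> x \<tau> j" using less.prems by simp
  qed simp
  thus ?case
    by (rule borel_measurable_LIMSEQ_real) (use Rm in measurable)
qed

lemma measurable_pow_mat_entry:
  fixes A :: "'a \<Rightarrow> complex mat"
  assumes A: "\<And>\<tau>. A \<tau> \<in> carrier_mat n n"
    and meas: "\<And>i j. i < n \<Longrightarrow> j < n \<Longrightarrow> (\<lambda>\<tau>. A \<tau> $$ (i, j)) \<in> borel_measurable M"
    and ij: "i < n" "j < n"
  shows "(\<lambda>\<tau>. (A \<tau> ^\<^sub>m k) $$ (i, j)) \<in> borel_measurable M"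
  using ij
proof (induction k arbitrary: j)
  case 0
  thus ?case using carrier_matD(1)[OF A] by simp
next
  case (Suc k)
  have "(A \<tau> ^\<^sub>m Suc k) $$ (i, j) = (\<Sum>l<n. (A \<tau> ^\<^sub>m k) $$ (i, l) * A \<tau> $$ (l, j))" for \<tau>
    using A[of \<tau>] Suc.prems by (auto simp: scalar_prod_def atLeast0LessThan intro!: sum.cong)
  thus ?case using Suc meas by (auto intro!: borel_measurable_sum borel_measurable_times)
qed

section \<open>Extended-valued integrals and difference quotients of powers\<close>

lemma eint_ereal:
  assumes "integrable M l"
  shows "eint M (\<lambda>\<tau>. ereal (l \<tau>)) = ereal (\<integral>\<tau>. l \<tau> \<partial>M)"
proof -
  have fin: "(\<integral>\<^sup>+ \<tau>. ennreal (l \<tau>) \<partial>M) < \<infinity>" "(\<integral>\<^sup>+ \<tau>. ennreal (- l \<tau>) \<partial>M) < \<infinity>"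
    using assms by (auto simp: real_integrable_def top.not_eq_extremum)
  have real: "enn2ereal A = ereal (enn2real A)" if "A < \<infinity>" for A
    using that by (cases A) auto
  show ?thesis
    using real[OF fin(1)] real[OF fin(2)]
    by (simp add: eint_def real_lebesgue_integral_def[OF assms])
qed

text \<open>\<open>h\<close> may be non-measurable: the nonnegative integral is monotone for
  arbitrary functions. The negative part of \<open>h\<close> lies almost everywhere below that of
  \<open>l\<close>, so its integral is finite and the difference is never infinity minus
  infinity.\<close>

lemma eint_ge:
  assumes l: "integrable M l" and le: "AE \<tau> in M. ereal (l \<tau>) \<le> h \<tau>"
  shows "ereal (\<integral>\<tau>. l \<tau> \<partial>M) \<le> eint M h"
proof -
  have "AE \<tau> in M. e2ennreal (ereal (l \<tau>)) \<le> e2ennreal (h \<tau>)"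
    "AE \<tau> in M. e2ennreal (- h \<tau>) \<le> e2ennreal (- ereal (l \<tau>))"
    using le by (auto elim!: eventually_mono intro!: e2ennreal_mono simp: ereal_minus_le_minus simp del: uminus_ereal.simps e2ennreal_ereal)
  hence "eint M (\<lambda>\<tau>. ereal (l \<tau>)) \<le> eint M h"
    unfolding eint_def
    by (intro ereal_minus_mono) (auto intro!: nn_integral_mono_AE simp flip: less_eq_ennreal.rep_eq simp del: uminus_ereal.simps)
  thus ?thesis by (simp add: eint_ereal[OF l])
qed

lemma eint_eq:
  assumes l: "integrable M l" and eq: "AE \<tau> in M. h \<tau> = ereal (l \<tau>)"
  shows "eint M h = ereal (\<integral>\<tau>. l \<tau> \<partial>M)"
proof -
  have "eint M h = eint M (\<lambda>\<tau>. ereal (l \<tau>))"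
    unfolding eint_def using eq
    by (intro arg_cong2[where f = "(-)"] arg_cong[where f = enn2ereal] nn_integral_cong_AE) auto
  thus ?thesis by (simp add: eint_ereal[OF l])
qed

lemma ln_le_powr_quotient:
  assumes "0 < z" "0 < (q :: real)"
  shows "ln z \<le> (z powr q - 1) / q"
  using exp_ge_add_one_self[of "q * ln z"] assms by (simp add: powr_def field_simps)

lemma powr_quotient_le:
  assumes "0 < z" "0 < (q :: real)"
  shows "(z powr q - 1) / q \<le> ln z * z powr q"
proof -
  have "1 - q * ln z \<le> exp (- (q * ln z))" using exp_ge_add_one_self[of "- (q * ln z)"] by simp
  hence "(1 - q * ln z) * z powr q \<le> exp (- (q * ln z)) * z powr q" by (intro mult_right_mono) auto
  also have "\<dots> = 1" using assms by (simp add: powr_def flip: exp_add)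
  finally show ?thesis using assms by (simp add: field_simps)
qed

text \<open>Convexity of \<open>exp\<close> between 0 and \<open>ln z\<close>. The bound is uniform
  in \<open>q\<close> and supplies the dominating function for the limit of the quotients.\<close>

lemma powr_quotient_le_minus_one:
  assumes z: "0 < z" and q: "0 < q" "(q :: real) \<le> 1"
  shows "(z powr q - 1) / q \<le> z - 1"
proof -
  have "z powr q \<le> (1 - q) + q * z"
    using convex_onD[OF exp_convex, of q 0 "ln z"] z q by (simp add: powr_def)
  thus ?thesis using q by (simp add: field_simps)
qed

lemma integral_powr_quotient_tendsto:
  fixes Z :: "'a \<Rightarrow> real"
  assumes Z: "integrable M Z" "integrable M (\<lambda>\<tau>. ln (Z \<tau>))" and pos: "AE \<tau> in M. 0 < Z \<tau>"
    and "prob_space M"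
  shows "(\<lambda>n. \<integral>\<tau>. (Z \<tau> powr (1 / Suc n) - 1) / (1 / Suc n) \<partial>M) \<longlonglongrightarrow> (\<integral>\<tau>. ln (Z \<tau>) \<partial>M)"
proof -
  interpret prob_space M by fact
  note [measurable] = borel_measurable_integrable[OF Z(1)] borel_measurable_integrable[OF Z(2)]
  show ?thesis
  proof (rule integral_dominated_convergence[where w = "\<lambda>\<tau>. \<bar>ln (Z \<tau>)\<bar> + \<bar>Z \<tau>\<bar> + 1"])
    show "integrable M (\<lambda>\<tau>. \<bar>ln (Z \<tau>)\<bar> + \<bar>Z \<tau>\<bar> + 1)" using Z by simp
    show "AE \<tau> in M. (\<lambda>n. (Z \<tau> powr (1 / Suc n) - 1) / (1 / Suc n)) \<longlonglongrightarrow> ln (Z \<tau>)"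
      using pos
    proof eventually_elim
      case (elim \<tau>)
      have "(\<lambda>n. ln (Z \<tau>) * Z \<tau> powr (1 / Suc n)) \<longlonglongrightarrow> ln (Z \<tau>) * Z \<tau> powr 0"
        using elim LIMSEQ_inverse_real_of_nat
        by (intro tendsto_mult tendsto_powr tendsto_const) (auto simp: inverse_eq_divide)
      hence lim: "(\<lambda>n. ln (Z \<tau>) * Z \<tau> powr (1 / Suc n)) \<longlonglongrightarrow> ln (Z \<tau>)" using elim by simp
      show ?case
        using elim ln_le_powr_quotient[of "Z \<tau>" "1 / Suc _"] powr_quotient_le[of "Z \<tau>" "1 / Suc _"]
        by (intro tendsto_sandwich[OF _ _ tendsto_const lim] always_eventually allI)
          (simp_all only: zero_less_divide_1_iff of_nat_0_less_iff zero_less_Suc)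
    qed
    show "AE \<tau> in M. norm ((Z \<tau> powr (1 / Suc n) - 1) / (1 / Suc n)) \<le> \<bar>ln (Z \<tau>)\<bar> + \<bar>Z \<tau>\<bar> + 1" for n
      using pos
    proof eventually_elim
      case (elim \<tau>)
      have "ln (Z \<tau>) \<le> (Z \<tau> powr (1 / Suc n) - 1) / (1 / Suc n)"
        using elim by (intro ln_le_powr_quotient) auto
      moreover have "(Z \<tau> powr (1 / Suc n) - 1) / (1 / Suc n) \<le> Z \<tau> - 1"
        using elim by (intro powr_quotient_le_minus_one) auto
      ultimately show ?case unfolding real_norm_def by linarith
    qed
  qed (measurable)
qed

text \<open>Jensen's inequality for the logarithm from its tangent line at \<open>exp c\<close>,
  where \<open>c\<close> is the mean of the logarithm.\<close>

lemma exp_integral_ln_le: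
  fixes G :: "'a \<Rightarrow> real"
  assumes "integrable M G" "integrable M (\<lambda>\<tau>. ln (G \<tau>))" and pos: "AE \<tau> in M. 0 < G \<tau>"
    and "prob_space M"
  shows "exp (\<integral>\<tau>. ln (G \<tau>) \<partial>M) \<le> (\<integral>\<tau>. G \<tau> \<partial>M)"
proof -
  interpret prob_space M by fact
  define c where "c = (\<integral>\<tau>. ln (G \<tau>) \<partial>M)"
  have "(\<integral>\<tau>. ln (G \<tau>) \<partial>M) \<le> (\<integral>\<tau>. c + exp (- c) * G \<tau> - 1 \<partial>M)"
  proof (rule Bochner_Integration.integral_mono_AE)
    show "AE \<tau> in M. ln (G \<tau>) \<le> c + exp (- c) * G \<tau> - 1"
      using pos
    proof eventually_elim
      case (elim \<tau>)
      have "ln (exp (- c) * G \<tau>) \<le> exp (- c) * G \<tau> - 1" using elim by (intro ln_le_minus_one) auto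
      thus ?case using elim by (simp add: ln_mult)
    qed
  qed (use assms in auto)
  also have "\<dots> = c + exp (- c) * (\<integral>\<tau>. G \<tau> \<partial>M) - 1" using assms by (simp add: prob_space)
  finally have "1 \<le> exp (- c) * (\<integral>\<tau>. G \<tau> \<partial>M)" unfolding c_def by simp
  hence "exp c * 1 \<le> exp c * (exp (- c) * (\<integral>\<tau>. G \<tau> \<partial>M))" by (intro mult_left_mono) auto
  thus ?thesis unfolding c_def by (simp add: mult.assoc[symmetric] flip: exp_add)
qed

section \<open>Families of TPSD tensors\<close>

lemma tpsd_teig_nonneg: "tpsd m p C \<Longrightarrow> i < m * p \<Longrightarrow> 0 \<le> teig m p C i"
  using set_teig_list[of m p C] by (auto simp: tpsd_def)

locale tpsd_family = prob_space \<nu> for \<nu> :: "'a::metric_space measure" +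
  fixes m p :: nat and D :: "'a \<Rightarrow> nat \<Rightarrow> real mat"
  assumes size_pos: "0 < m * p"
    and sets_eq: "sets \<nu> = sets borel"
    and tpsd: "\<And>\<tau>. tpsd m p (D \<tau>)"
    and cont: "\<And>k i j. k < p \<Longrightarrow> i < m \<Longrightarrow> j < m \<Longrightarrow> continuous_on UNIV (\<lambda>\<tau>. D \<tau> k $$ (i, j))"
    and bdd: "bdd_above (range (\<lambda>\<tau>. topnorm m p (D \<tau>)))"
    and neg_moments: "\<And>q::real. 0 < q \<Longrightarrow>
      (\<integral>\<^sup>+ \<tau>. fnorm sum_list m p (\<lambda>x. x powr (- q)) (D \<tau>) \<partial>\<nu>) < \<infinity>"
begin

abbreviation "N \<equiv> m * p"
abbreviation "lam \<tau> i \<equiv> teig m p (D \<tau>) i"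

lemma tsym: "tsym m p (D \<tau>)"
  using tpsd by (simp add: tpsd_def)

lemmas lam_nonneg = tpsd_teig_nonneg[OF tpsd]
lemmas antimono_lam = antimono_teig[OF tsym]

lemma lam_measurable:
  assumes "i < N"
  shows "(\<lambda>\<tau>. lam \<tau> i) \<in> borel_measurable \<nu>"
proof (rule measurable_from_power_sums[OF lam_nonneg antimono_lam _ assms])
  fix k
  have dims: "tensor_dims m m p (D \<tau>)" for \<tau> using tsym by (simp add: tsym_def)
  have "(\<lambda>\<tau>. D \<tau> l $$ (i, j)) \<in> borel_measurable \<nu>" if "l < p" "i < m" "j < m" for l i j
    using borel_measurable_continuous_onI[OF cont[OF that]] measurable_cong_sets[OF sets_eq refl] by auto
  hence "(\<lambda>\<tau>. fblock m p (cplx_tensor (D \<tau>)) a $$ (i, j)) \<in> borel_measurable \<nu>"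
    if "a < p" "i < m" "j < m" for a i j
    using that unfolding fblock_index[OF that]
    by (intro borel_measurable_sum borel_measurable_times borel_measurable_const)
      (simp add: cplx_tensor_index[OF dims])
  hence "(\<lambda>\<tau>. (fblock m p (cplx_tensor (D \<tau>)) a ^\<^sub>m k) $$ (i, i)) \<in> borel_measurable \<nu>"
    if "a < p" "i < m" for a i
    using that by (intro measurable_pow_mat_entry[where n = m]) auto
  hence "(\<lambda>\<tau>. \<Sum>a<p. \<Sum>i<m. (fblock m p (cplx_tensor (D \<tau>)) a ^\<^sub>m k) $$ (i, i)) \<in> borel_measurable \<nu>"
    by (intro borel_measurable_sum) auto
  hence "(\<lambda>\<tau>. Re (\<Sum>a<p. \<Sum>i<m. (fblock m p (cplx_tensor (D \<tau>)) a ^\<^sub>m k) $$ (i, i))) \<in> borel_measurable \<nu>"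
    by measurable
  moreover have "Re (\<Sum>a<p. \<Sum>i<m. (fblock m p (cplx_tensor (D \<tau>)) a ^\<^sub>m k) $$ (i, i)) = (\<Sum>i<N. lam \<tau> i ^ k)" for \<tau>
    unfolding sum_power_teig_list[OF tsym, symmetric]
    using length_teig_list[OF tsym, of \<tau>] by (simp add: sum_list_sum_nth atLeast0LessThan)
  ultimately show "(\<lambda>\<tau>. \<Sum>i<N. lam \<tau> i ^ k) \<in> borel_measurable \<nu>" by simp
qed

lemma lam_bounded: "\<exists>K. \<forall>\<tau>. \<forall>i<N. lam \<tau> i \<le> K"
proof -
  obtain K where K: "\<And>\<tau>. topnorm m p (D \<tau>) \<le> K" using bdd by (auto simp: bdd_above_def)
  have "lam \<tau> i \<le> K" if i: "i < N" for \<tau> i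
  proof -
    have "set (tsval_list m p (cplx_tensor (D \<tau>))) = abs ` set (teig_list m p (D \<tau>))"
      using arg_cong[OF mset_tsval_list[OF tsym, of \<tau>], of set_mset] by simp
    hence "\<bar>lam \<tau> i\<bar> \<in> insert 0 (set (tsval_list m p (cplx_tensor (D \<tau>))))"
      using i by (auto simp: set_teig_list[OF tsym])
    hence "\<bar>lam \<tau> i\<bar> \<le> topnorm m p (D \<tau>)"
      unfolding topnorm_def tnorm_def by (intro Max_ge) auto
    thus ?thesis using K[of \<tau>] by linarith
  qed
  thus ?thesis by blast
qed

lemma integrable_lam:
  assumes i: "i < N"
  shows "integrable \<nu> (\<lambda>\<tau>. lam \<tau> i)"
proof -
  obtain K where "\<forall>\<tau>. \<forall>i<N. lam \<tau> i \<le> K" using lam_bounded by blast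
  thus ?thesis using i lam_nonneg[OF i] lam_measurable[OF i]
    by (intro integrable_const_bound[where B = K]) auto
qed

text \<open>A single lower bound with two uses: its infinite value shows that zero T-eigenvalues
  form a null set, its finite values show that negative powers are integrable.\<close>

lemma fnorm_neg_powr_ge:
  assumes i: "i < N" and q: "0 < q"
  shows "(if lam \<tau> i = 0 then \<infinity> else ennreal (lam \<tau> i powr (- q))) \<le> fnorm sum_list m p (\<lambda>x. x powr (- q)) (D \<tau>)"
proof (cases "0 \<in> set (teig_list m p (D \<tau>))")
  case True
  thus ?thesis by (simp add: fnorm_def flim0_neg_powr[OF q])
next
  case False
  hence nz: "lam \<tau> j \<noteq> 0" if "j < N" for j using that unfolding set_teig_list[OF tsym] by auto
  let ?h = "fext (\<lambda>x. x powr (- q))"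
  have "tnorm sum_list m p (tfun m p ?h (cplx_tensor (D \<tau>))) = vgauge N sum_list (\<lambda>i. \<bar>?h (lam \<tau> i)\<bar>)"
    by (rule tnorm_tfun[OF tsym]) (metis sum_mset_sum_list)
  also have "\<dots> = (\<Sum>i<N. \<bar>?h (lam \<tau> i)\<bar>)" by (simp add: sum_list_sum_nth atLeast0LessThan)
  also have "\<dots> \<ge> \<bar>?h (lam \<tau> i)\<bar>" using i by (intro member_le_sum) auto
  also have "\<bar>?h (lam \<tau> i)\<bar> = lam \<tau> i powr (- q)"
    using nz[OF i] lam_nonneg[OF i, of \<tau>] by (simp add: fext_def)
  finally show ?thesis using False nz[OF i] by (simp add: fnorm_def ennreal_leI)
qed

text \<open>The zero set of one T-eigenvalue, weighted with infinity, is bounded by the finite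
  moment for q = 1 and so has measure 0.\<close>

lemma AE_lam_pos: "AE \<tau> in \<nu>. \<forall>i<N. 0 < lam \<tau> i"
proof -
  have "AE \<tau> in \<nu>. 0 < lam \<tau> i" if i: "i < N" for i
  proof -
    note [measurable] = lam_measurable[OF i]
    let ?Z = "{\<tau> \<in> space \<nu>. lam \<tau> i = 0}"
    have Z: "?Z \<in> sets \<nu>" by measurable
    have "\<infinity> * emeasure \<nu> ?Z = (\<integral>\<^sup>+ \<tau>. \<infinity> * indicator ?Z \<tau> \<partial>\<nu>)"
      using Z by (simp add: nn_integral_cmult_indicator)
    also have "\<dots> \<le> (\<integral>\<^sup>+ \<tau>. fnorm sum_list m p (\<lambda>x. x powr (- 1)) (D \<tau>) \<partial>\<nu>)"
    proof (rule nn_integral_mono)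
      fix \<tau> show "\<infinity> * indicator ?Z \<tau> \<le> fnorm sum_list m p (\<lambda>x. x powr (- 1)) (D \<tau>)"
        using fnorm_neg_powr_ge[OF i, of 1 \<tau>] by (auto simp: indicator_def split: if_splits)
    qed
    also have "\<dots> < \<infinity>" using neg_moments[of 1] by simp
    finally have "emeasure \<nu> ?Z = 0" by (auto simp: ennreal_top_mult split: if_splits)
    hence "AE \<tau> in \<nu>. lam \<tau> i \<noteq> 0" using Z by (intro AE_I[of _ _ ?Z]) auto
    thus ?thesis using lam_nonneg[OF i] by (auto simp: less_le)
  qed
  thus ?thesis by (simp add: AE_all_countable)
qed

lemma integrable_lam_powr_neg:
  assumes i: "i < N" and q: "0 < q"
  shows "integrable \<nu> (\<lambda>\<tau>. lam \<tau> i powr (- q))"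
proof (rule integrableI_bounded)
  note [measurable] = lam_measurable[OF i]
  show "(\<lambda>\<tau>. lam \<tau> i powr (- q)) \<in> borel_measurable \<nu>" by measurable
  have "(\<integral>\<^sup>+ \<tau>. ennreal (norm (lam \<tau> i powr (- q))) \<partial>\<nu>)
      \<le> (\<integral>\<^sup>+ \<tau>. fnorm sum_list m p (\<lambda>x. x powr (- q)) (D \<tau>) \<partial>\<nu>)"
  proof (rule nn_integral_mono)
    fix \<tau> show "ennreal (norm (lam \<tau> i powr (- q))) \<le> fnorm sum_list m p (\<lambda>x. x powr (- q)) (D \<tau>)"
      using fnorm_neg_powr_ge[OF i q, of \<tau>] by (auto split: if_splits)
  qed
  also have "\<dots> < \<infinity>" by (rule neg_moments[OF q])
  finally show "(\<integral>\<^sup>+ \<tau>. ennreal (norm (lam \<tau> i powr (- q))) \<partial>\<nu>) < \<infinity>" .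
qed

text \<open>Both signs of \<open>s\<close> are dominated by 1 + x + 1/x. The range of
  \<open>s\<close> up to 1 in absolute value suffices because the exponents tend to 0 in the
  limit.\<close>

lemma integrable_lam_powr:
  assumes i: "i < N" and s: "\<bar>s\<bar> \<le> 1"
  shows "integrable \<nu> (\<lambda>\<tau>. lam \<tau> i powr s)"
proof (rule Bochner_Integration.integrable_bound[of _ "\<lambda>\<tau>. 1 + lam \<tau> i + lam \<tau> i powr (- 1)"])
  note [measurable] = lam_measurable[OF i]
  show "integrable \<nu> (\<lambda>\<tau>. 1 + lam \<tau> i + lam \<tau> i powr (- 1))"
    using integrable_lam[OF i] integrable_lam_powr_neg[OF i, of 1] by simp
  show "(\<lambda>\<tau>. lam \<tau> i powr s) \<in> borel_measurable \<nu>" by measurable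
  show "AE \<tau> in \<nu>. norm (lam \<tau> i powr s) \<le> norm (1 + lam \<tau> i + lam \<tau> i powr (- 1))"
    using AE_lam_pos
  proof eventually_elim
    case (elim \<tau>)
    let ?x = "lam \<tau> i"
    have x: "0 < ?x" using elim i by blast
    have "?x powr s \<le> 1 + ?x + ?x powr (- 1)"
    proof (cases "1 \<le> ?x")
      case True
      hence "?x powr s \<le> ?x powr 1" using s by (intro powr_mono) auto
      moreover have "0 \<le> ?x powr (- 1)" by (rule powr_ge_zero)
      moreover have "?x powr 1 = ?x" using x by simp
      ultimately show ?thesis by linarith
    next
      case False
      hence "?x powr s \<le> ?x powr (- 1)" using s x by (intro powr_mono') auto
      thus ?thesis using x by linarith
    qed
    thus ?case using x by simp
  qed
qed

lemma integrable_ln_lam: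
  assumes i: "i < N"
  shows "integrable \<nu> (\<lambda>\<tau>. ln (lam \<tau> i))"
proof (rule Bochner_Integration.integrable_bound[of _ "\<lambda>\<tau>. lam \<tau> i + lam \<tau> i powr (- 1)"])
  note [measurable] = lam_measurable[OF i]
  show "integrable \<nu> (\<lambda>\<tau>. lam \<tau> i + lam \<tau> i powr (- 1))"
    using integrable_lam[OF i] integrable_lam_powr_neg[OF i, of 1] by simp
  show "(\<lambda>\<tau>. ln (lam \<tau> i)) \<in> borel_measurable \<nu>" by measurable
  show "AE \<tau> in \<nu>. norm (ln (lam \<tau> i)) \<le> norm (lam \<tau> i + lam \<tau> i powr (- 1))"
    using AE_lam_pos
  proof eventually_elim
    case (elim \<tau>)
    let ?x = "lam \<tau> i"
    have x: "0 < ?x" using elim i by blast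
    have "ln ?x \<le> ?x - 1" using x by (rule ln_le_minus_one)
    moreover have "- ln ?x \<le> ?x powr (- 1) - 1"
      using ln_le_minus_one[of "?x powr (- 1)"] x by (simp add: ln_div)
    moreover have "0 \<le> ?x powr (- 1)" by simp
    ultimately show ?case using x unfolding real_norm_def by linarith
  qed
qed

definition mean_ln :: "nat \<Rightarrow> real" where "mean_ln i = (\<integral>\<tau>. ln (lam \<tau> i) \<partial>\<nu>)"

lemma antimono_mean_ln: "antimono_on {..<N} mean_ln"
proof (rule monotone_onI)
  fix i j assume ij: "i \<in> {..<N}" "j \<in> {..<N}" "i \<le> j"
  show "mean_ln j \<le> mean_ln i" unfolding mean_ln_def
  proof (rule Bochner_Integration.integral_mono_AE)
    show "AE \<tau> in \<nu>. ln (lam \<tau> j) \<le> ln (lam \<tau> i)"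
      using AE_lam_pos
    proof eventually_elim
      case (elim \<tau>)
      have "lam \<tau> j \<le> lam \<tau> i" using monotone_onD[OF antimono_lam ij, of \<tau>] .
      moreover have "0 < lam \<tau> j" using elim ij by auto
      ultimately show ?case by simp
    qed
  qed (use ij integrable_ln_lam in auto)
qed

lemma eexp_eint_eln_lam:
  assumes i: "i < N"
  shows "eexp (eint \<nu> (\<lambda>\<tau>. eln (lam \<tau> i))) = ereal (exp (mean_ln i))"
proof -
  have "AE \<tau> in \<nu>. eln (lam \<tau> i) = ereal (ln (lam \<tau> i))"
    using AE_lam_pos by eventually_elim (use i in \<open>simp add: eln_def\<close>)
  hence "eint \<nu> (\<lambda>\<tau>. eln (lam \<tau> i)) = ereal (mean_ln i)"
    unfolding mean_ln_def by (rule eint_eq[OF integrable_ln_lam[OF i]])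
  thus ?thesis by (simp add: eexp_def)
qed

text \<open>Ordinary majorization of the logarithms by their means. Positivity is a separate clause
  because the real \<open>ln\<close> has a finite value at 0 and would conceal a zero entry.\<close>

definition ln_majorized :: "(nat \<Rightarrow> real) \<Rightarrow> bool" where
  "ln_majorized x \<longleftrightarrow> (\<forall>i<N. 0 < x i) \<and>
     (\<forall>k\<le>N. (\<Sum>i<k. ln (x i)) \<le> sum mean_ln {..<k}) \<and>
     (\<Sum>i<N. ln (x i)) = sum mean_ln {..<N}"

end

section \<open>Log-majorization as majorization of logarithms\<close>

lemma prod_list_map_ereal: "prod_list (map ereal xs) = ereal (prod_list xs)"
  by (induction xs) (auto simp: one_ereal_def)

lemma prod_list_take_map_upt:
  "k \<le> n \<Longrightarrow> prod_list (take k (map (\<lambda>i. ereal (x i)) [0..<n])) = ereal (\<Prod>i<k. x i)"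
proof -
  assume k: "k \<le> n"
  have "take k (map (\<lambda>i. ereal (x i)) [0..<n]) = map ereal (map x [0..<k])"
    using k by (simp add: take_map)
  hence "prod_list (take k (map (\<lambda>i. ereal (x i)) [0..<n])) = ereal (prod_list (map x [0..<k]))"
    by (simp only: prod_list_map_ereal)
  thus ?thesis by (simp add: prod.list_conv_set_nth atLeast0LessThan)
qed

lemma rev_sort_antimono:
  assumes "antimono_on {..<n} (x :: nat \<Rightarrow> 'b :: linorder)"
  shows "rev (sort (map x [0..<n])) = map x [0..<n]"
proof -
  have "sorted (rev (map x [0..<n]))"
    using monotone_onD[OF assms] by (auto simp: sorted_wrt_iff_nth_less rev_nth)
  hence "sort (map x [0..<n]) = rev (map x [0..<n])" by (intro properties_for_sort) auto
  thus ?thesis by simp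
qed

lemma logmaj_iff_prod:
  assumes x: "antimono_on {..<n} x" and y: "antimono_on {..<n} y"
  shows "logmaj (map (\<lambda>i. ereal (x i)) [0..<n]) (map (\<lambda>i. ereal (y i)) [0..<n]) \<longleftrightarrow>
    (\<forall>k\<le>n. (\<Prod>i<k. x i) \<le> (\<Prod>i<k. y i)) \<and> (\<Prod>i<n. x i) = (\<Prod>i<n. y i)"
proof -
  have e: "antimono_on {..<n} (\<lambda>i. ereal (z i))" if "antimono_on {..<n} z" for z
    using that by (auto simp: monotone_on_def)
  have full: "prod_list (map (\<lambda>i. ereal (z i)) [0..<n]) = ereal (\<Prod>i<n. z i)" for z
    using prod_list_take_map_upt[of n n z] by simp
  \<comment> \<open>\<open>logmaj\<close> starts at k = 1; for k = 0 both products are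
    empty.\<close>
  have "(\<forall>k. 1 \<le> k \<and> k \<le> n \<longrightarrow> (\<Prod>i<k. x i) \<le> (\<Prod>i<k. y i)) \<longleftrightarrow> (\<forall>k\<le>n. (\<Prod>i<k. x i) \<le> (\<Prod>i<k. y i))"
    by (metis less_one linorder_not_le order_refl prod.lessThan_Suc lessThan_0 prod.empty)
  thus ?thesis
    unfolding logmaj_def rev_sort_antimono[OF e[OF x]] rev_sort_antimono[OF e[OF y]] full
    by (auto simp: prod_list_take_map_upt)
qed

context tpsd_family
begin

lemma logmaj_iff_ln_majorized:
  assumes C: "tpsd m p C"
  shows "logmaj (map ereal (teig_list m p C))
      (map (\<lambda>i. eexp (eint \<nu> (\<lambda>\<tau>. eln (lam \<tau> i)))) [0..<N]) \<longleftrightarrow> ln_majorized (teig m p C)"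
proof -
  let ?x = "teig m p C" and ?y = "\<lambda>i. exp (mean_ln i)"
  have Cs: "tsym m p C" using C by (simp add: tpsd_def)
  have eqC: "map ereal (teig_list m p C) = map (\<lambda>i. ereal (?x i)) [0..<N]"
    using arg_cong[OF map_teig[OF Cs], of "map ereal"] by (simp add: o_def)
  have eqD: "map (\<lambda>i. eexp (eint \<nu> (\<lambda>\<tau>. eln (lam \<tau> i)))) [0..<N] = map (\<lambda>i. ereal (?y i)) [0..<N]"
    using eexp_eint_eln_lam by simp
  have "antimono_on {..<N} ?y"
    using antimono_mean_ln by (auto simp: monotone_on_def)
  hence "logmaj (map ereal (teig_list m p C))
      (map (\<lambda>i. eexp (eint \<nu> (\<lambda>\<tau>. eln (lam \<tau> i)))) [0..<N]) \<longleftrightarrow>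
    (\<forall>k\<le>N. (\<Prod>i<k. ?x i) \<le> (\<Prod>i<k. ?y i)) \<and> (\<Prod>i<N. ?x i) = (\<Prod>i<N. ?y i)" (is "?A \<longleftrightarrow> ?B")
    unfolding eqC eqD by (rule logmaj_iff_prod[OF antimono_teig[OF Cs]])
  also have "?B \<longleftrightarrow> ln_majorized ?x"
  proof -
    have Y: "(\<Prod>i<k. ?y i) = exp (sum mean_ln {..<k})" for k by (simp add: exp_sum)
    have X: "(\<Prod>i<k. ?x i) = exp (\<Sum>i<k. ln (?x i))" if "\<forall>i<N. 0 < ?x i" "k \<le> N" for k
      using that by (simp add: exp_sum)
    \<comment> \<open>A zero T-eigenvalue would annihilate the left product, while the right one is
      an exponential.\<close>
    have pos: "\<forall>i<N. 0 < ?x i" if "(\<Prod>i<N. ?x i) = (\<Prod>i<N. ?y i)"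
    proof -
      have "(\<Prod>i<N. ?x i) \<noteq> 0" unfolding that Y by simp
      thus ?thesis using tpsd_teig_nonneg[OF C] by (auto simp: less_le)
    qed
    show ?thesis
    proof
      assume B: ?B
      show "ln_majorized ?x"
        using B X[OF pos] Y pos unfolding ln_majorized_def by auto
    next
      assume "ln_majorized ?x"
      thus ?B using X Y unfolding ln_majorized_def by auto
    qed
  qed
  finally show ?thesis .
qed

end

section \<open>From majorization to the norm inequalities\<close>

context tpsd_family
begin

lemma fnorm_family:
  assumes "sym_gauge N \<rho>"
  shows "AE \<tau> in \<nu>. fnorm \<rho> m p f (D \<tau>) = ennreal (vgauge N \<rho> (\<lambda>i. f (lam \<tau> i)))"
  using AE_lam_pos by eventually_elim (rule fnorm_eq[OF tsym _ assms], blast)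

text \<open>The outer function \<open>\<Psi>\<close> lets one statement serve both kinds of bound:
  it is the identity for integrals of norms and \<open>ln\<close> for integrals of their
  logarithms.\<close>

lemma ln_majorized_minorant:
  assumes C: "tpsd m p C" and maj: "ln_majorized (teig m p C)" and \<rho>: "sym_gauge N \<rho>"
    and conv: "coord_convex (\<lambda>u. \<Psi> (vgauge N \<rho> (\<lambda>i. \<phi> (u i))))"
  shows "\<exists>l. integrable \<nu> l \<and>
    (AE \<tau> in \<nu>. l \<tau> \<le> \<Psi> (vgauge N \<rho> (\<lambda>i. \<phi> (ln (lam \<tau> i))))) \<and>
    \<Psi> (vgauge N \<rho> (\<lambda>i. \<phi> (ln (teig m p C i)))) \<le> (\<integral>\<tau>. l \<tau> \<partial>\<nu>)"
proof -
  let ?\<Phi> = "\<lambda>u. \<Psi> (vgauge N \<rho> (\<lambda>i. \<phi> (u i)))" and ?a = "\<lambda>i. ln (teig m p C i)"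
  have Cs: "tsym m p C" using C by (simp add: tpsd_def)
  have "\<exists>l. integrable \<nu> l \<and> (\<forall>\<tau>. l \<tau> \<le> ?\<Phi> (\<lambda>i. ln (lam \<tau> i))) \<and> ?\<Phi> ?a \<le> (\<integral>\<tau>. l \<tau> \<partial>\<nu>)"
  proof (rule majorized_jensen_minorant[OF prob_space_axioms conv])
    fix u :: "nat \<Rightarrow> real" and \<pi> assume "\<pi> permutes {..<N}"
    thus "?\<Phi> (u \<circ> \<pi>) = ?\<Phi> u"
      using gauge_permute[OF \<rho>, of \<pi> "\<lambda>i. \<phi> (u i)"] by (simp add: o_def)
  next
    fix u v :: "nat \<Rightarrow> real" assume "\<And>i. i < N \<Longrightarrow> u i = v i"
    thus "?\<Phi> u = ?\<Phi> v" by (intro arg_cong[where f = \<Psi>] arg_cong[where f = \<rho>] map_cong) auto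
  next
    show "antimono_on {..<N} ?a"
    proof (rule monotone_onI)
      fix i j assume ij: "i \<in> {..<N}" "j \<in> {..<N}" "i \<le> j"
      have "0 < teig m p C j" using maj ij by (auto simp: ln_majorized_def)
      thus "?a j \<le> ?a i" using monotone_onD[OF antimono_teig[OF Cs] ij] by simp
    qed
  next
    show "sum ?a {..<k} \<le> (\<Sum>i<k. \<integral>\<tau>. ln (lam \<tau> i) \<partial>\<nu>)" if "k < N" for k
      using maj that by (simp add: ln_majorized_def mean_ln_def)
    show "sum ?a {..<N} = (\<Sum>i<N. \<integral>\<tau>. ln (lam \<tau> i) \<partial>\<nu>)"
      using maj by (simp add: ln_majorized_def mean_ln_def)
  qed (rule integrable_ln_lam)
  thus ?thesis by auto
qed

lemma convex_bound_of_ln_majorized: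
  assumes C: "tpsd m p C" and maj: "ln_majorized (teig m p C)" and \<rho>: "sym_gauge N \<rho>"
    and nn: "\<And>x. 0 < x \<Longrightarrow> 0 \<le> g x" and conv: "convex_on UNIV (\<lambda>x. g (exp x))"
  shows "fnorm \<rho> m p g C \<le> (\<integral>\<^sup>+ \<tau>. fnorm \<rho> m p g (D \<tau>) \<partial>\<nu>)"
proof -
  have Cs: "tsym m p C" using C by (simp add: tpsd_def)
  have pos: "0 < teig m p C i" if "i < N" for i using maj that by (simp add: ln_majorized_def)
  have "coord_convex (\<lambda>u. vgauge N \<rho> (\<lambda>i. g (exp (u i))))"
    using coord_convex_gauge_comp[OF \<rho> conv] nn by simp
  from ln_majorized_minorant[where \<Psi> = "\<lambda>x. x" and \<phi> = "\<lambda>x. g (exp x)", OF C maj \<rho> this]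
  obtain l where l: "integrable \<nu> l"
    "AE \<tau> in \<nu>. l \<tau> \<le> vgauge N \<rho> (\<lambda>i. g (exp (ln (lam \<tau> i))))"
    "vgauge N \<rho> (\<lambda>i. g (exp (ln (teig m p C i)))) \<le> (\<integral>\<tau>. l \<tau> \<partial>\<nu>)" by auto
  have "fnorm \<rho> m p g C = ennreal (vgauge N \<rho> (\<lambda>i. g (teig m p C i)))"
    by (rule fnorm_eq[OF Cs pos \<rho>])
  also have "vgauge N \<rho> (\<lambda>i. g (teig m p C i)) = vgauge N \<rho> (\<lambda>i. g (exp (ln (teig m p C i))))"
    using pos by (intro arg_cong[where f = \<rho>] map_cong) auto
  also have "ennreal \<dots> \<le> ennreal (\<integral>\<tau>. l \<tau> \<partial>\<nu>)" by (rule ennreal_leI[OF l(3)])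
  \<comment> \<open>The minorant may be negative. Its positive part still lies below the norm, which
    is nonnegative, and can be passed to the nonnegative integral.\<close>
  also have "\<dots> \<le> ennreal (\<integral>\<tau>. max 0 (l \<tau>) \<partial>\<nu>)"
    using l(1) by (intro ennreal_leI Bochner_Integration.integral_mono_AE) auto
  also have "\<dots> = (\<integral>\<^sup>+ \<tau>. ennreal (max 0 (l \<tau>)) \<partial>\<nu>)"
    using l(1) by (intro nn_integral_eq_integral[symmetric]) auto
  also have "\<dots> \<le> (\<integral>\<^sup>+ \<tau>. fnorm \<rho> m p g (D \<tau>) \<partial>\<nu>)"
  proof (rule nn_integral_mono_AE)
    show "AE \<tau> in \<nu>. ennreal (max 0 (l \<tau>)) \<le> fnorm \<rho> m p g (D \<tau>)"
      using l(2) fnorm_family[OF \<rho>, of g] AE_lam_pos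
    proof eventually_elim
      case (elim \<tau>)
      have "vgauge N \<rho> (\<lambda>i. g (exp (ln (lam \<tau> i)))) = vgauge N \<rho> (\<lambda>i. g (lam \<tau> i))"
        using elim(3) by (intro arg_cong[where f = \<rho>] map_cong) auto
      thus ?case using elim gauge_nonneg[OF \<rho>] by (simp add: ennreal_leI)
    qed
  qed
  finally show ?thesis .
qed

lemma log_convex_bound_of_ln_majorized:
  assumes C: "tpsd m p C" and maj: "ln_majorized (teig m p C)" and \<rho>: "sym_gauge N \<rho>"
    and nn: "\<And>x. 0 < x \<Longrightarrow> 0 \<le> f x"
    and conv: "\<And>x y t. 0 \<le> t \<Longrightarrow> t \<le> 1 \<Longrightarrow> eln (f (exp ((1 - t) * x + t * y)))
      \<le> ereal (1 - t) * eln (f (exp x)) + ereal t * eln (f (exp y))"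
  shows "enn2ereal (fnorm \<rho> m p f C) \<le> eexp (eint \<nu> (\<lambda>\<tau>. elog (fnorm \<rho> m p f (D \<tau>))))"
proof -
  have Cs: "tsym m p C" using C by (simp add: tpsd_def)
  have pos: "0 < teig m p C i" if "i < N" for i using maj that by (simp add: ln_majorized_def)
  have fC: "fnorm \<rho> m p f C = ennreal (vgauge N \<rho> (\<lambda>i. f (teig m p C i)))"
    by (rule fnorm_eq[OF Cs pos \<rho>])
  show ?thesis
  proof (cases "\<exists>x. f (exp x) = 0")
    case True
    \<comment> \<open>A zero of \<open>f\<close> spreads to all of \<open>(0, \<infinity>)\<close>, because \<open>log f(e\<^sup>x)\<close> is \<open>-\<infinity>\<close> at one end of every segment.\<close>
    then obtain x0 where x0: "f (exp x0) = 0" by blast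
    have "f (exp z) = 0" for z
    proof -
      \<comment> \<open>The point \<open>z\<close> is the midpoint of \<open>x0\<close> and its
        reflection \<open>2 * z - x0\<close>. As \<open>eln\<close> never takes the value infinity,
        the right-hand side is minus infinity.\<close>
      have "eln (f (exp ((1 - 1/2) * x0 + 1/2 * (2 * z - x0)))) \<le>
        ereal (1 - 1/2) * eln (f (exp x0)) + ereal (1/2) * eln (f (exp (2 * z - x0)))"
        by (rule conv) auto
      also have "\<dots> = -\<infinity>"
        unfolding x0 by (auto simp: eln_def)
      finally have "eln (f (exp z)) = -\<infinity>" by (simp add: field_simps)
      thus ?thesis using nn[of "exp z"] by (auto simp: eln_def split: if_splits)
    qed
    hence "f (teig m p C i) = 0" if "i < N" for i using pos[OF that] by (metis exp_ln)
    hence "vgauge N \<rho> (\<lambda>i. f (teig m p C i)) = 0" unfolding gauge_eq_0_iff[OF \<rho>] by blast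
    thus ?thesis unfolding fC by (auto simp: eexp_def zero_ennreal.rep_eq split: ereal.split)
  next
    case False
    hence fpos: "0 < f x" if "0 < x" for x
      using nn[OF that] that by (metis exp_ln less_le)
    let ?\<phi> = "\<lambda>x. ln (f (exp x))"
    have \<phi>: "convex_on UNIV ?\<phi>"
    proof (intro convex_onI)
      fix t x y :: real assume t: "0 < t" "t < 1"
      show "?\<phi> ((1 - t) *\<^sub>R x + t *\<^sub>R y) \<le> (1 - t) * ?\<phi> x + t * ?\<phi> y"
        using conv[of t x y] t fpos by (simp add: eln_def)
    qed simp
    have "coord_convex (\<lambda>u. ln (vgauge N \<rho> (\<lambda>i. exp (?\<phi> (u i)))))"
      by (rule coord_convex_ln_gauge_exp_comp[OF \<rho> \<phi> size_pos])
    hence "coord_convex (\<lambda>u. ln (vgauge N \<rho> (\<lambda>i. f (exp (u i)))))" using fpos by simp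
    from ln_majorized_minorant[where \<Psi> = ln and \<phi> = "\<lambda>x. f (exp x)", OF C maj \<rho> this]
    obtain l where l: "integrable \<nu> l"
      "AE \<tau> in \<nu>. l \<tau> \<le> ln (vgauge N \<rho> (\<lambda>i. f (exp (ln (lam \<tau> i)))))"
      "ln (vgauge N \<rho> (\<lambda>i. f (exp (ln (teig m p C i))))) \<le> (\<integral>\<tau>. l \<tau> \<partial>\<nu>)" by auto
    have vpos: "0 < vgauge N \<rho> (\<lambda>i. f (exp (u i)))" for u
      using gauge_exp_pos[OF \<rho> size_pos, of "\<lambda>i. ?\<phi> (u i)"] fpos by simp
    have "AE \<tau> in \<nu>. ereal (l \<tau>) \<le> elog (fnorm \<rho> m p f (D \<tau>))"
      using l(2) fnorm_family[OF \<rho>, of f] AE_lam_pos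
    proof eventually_elim
      case (elim \<tau>)
      have "vgauge N \<rho> (\<lambda>i. f (exp (ln (lam \<tau> i)))) = vgauge N \<rho> (\<lambda>i. f (lam \<tau> i))"
        using elim(3) by (intro arg_cong[where f = \<rho>] map_cong) auto
      thus ?case using elim vpos[of "\<lambda>i. ln (lam \<tau> i)"] by (simp add: elog_def eln_def)
    qed
    from eint_ge[OF l(1) this]
    have "ereal (ln (vgauge N \<rho> (\<lambda>i. f (exp (ln (teig m p C i))))))
        \<le> eint \<nu> (\<lambda>\<tau>. elog (fnorm \<rho> m p f (D \<tau>)))"
      using l(3) by (metis ereal_less_eq(3) order_trans)
    moreover have "vgauge N \<rho> (\<lambda>i. f (exp (ln (teig m p C i)))) = vgauge N \<rho> (\<lambda>i. f (teig m p C i))"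
      using pos by (intro arg_cong[where f = \<rho>] map_cong) auto
    moreover have "ereal r \<le> eexp z" if "ereal (ln r) \<le> z" "0 < r" for r z
    proof (cases z)
      case (real x)
      have "r = exp (ln r)" using that by simp
      also have "\<dots> \<le> exp x" using that(1) unfolding real by (simp only: exp_le_cancel_iff ereal_less_eq)
      finally show ?thesis unfolding real by (simp add: eexp_def)
    qed (use that in \<open>auto simp: eexp_def\<close>)
    ultimately show ?thesis
      using vpos[of "\<lambda>i. ln (teig m p C i)"] unfolding fC by (simp add: enn2ereal_ennreal)
  qed
qed

text \<open>The part of (iii) that already implies (i), isolated as a common consequence of (ii) and
  (iii). The condition \<open>0 < s \<or> k = N\<close> restricts to the cases where the norm is the
  sum over the \<open>k\<close> largest T-eigenvalues.\<close>

definition ky_fan_power_bounds :: "(nat \<Rightarrow> real mat) \<Rightarrow> bool" where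
  "ky_fan_power_bounds C \<longleftrightarrow> (\<forall>s k. s \<noteq> 0 \<longrightarrow> \<bar>s\<bar> \<le> 1 \<longrightarrow> 1 \<le> k \<longrightarrow> k \<le> N \<longrightarrow> (0 < s \<or> k = N) \<longrightarrow>
     fnorm (ky_fan k) m p (\<lambda>x. x powr s) C \<le> (\<integral>\<^sup>+ \<tau>. fnorm (ky_fan k) m p (\<lambda>x. x powr s) (D \<tau>) \<partial>\<nu>))"

end

lemma vgauge_ky_fan_powr:
  assumes C: "tsym m p C" and pos: "\<And>i. i < m * p \<Longrightarrow> 0 < teig m p C i"
    and k: "k \<le> m * p" and s: "0 < s \<or> k = m * p"
  shows "vgauge (m * p) (ky_fan k) (\<lambda>i. teig m p C i powr s) = (\<Sum>i<k. teig m p C i powr s)"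
proof (cases "0 < s")
  case True
  have "antimono_on {..<m * p} (\<lambda>i. teig m p C i powr s)"
  proof (rule monotone_onI)
    fix i j assume ij: "i \<in> {..<m * p}" "j \<in> {..<m * p}" "i \<le> j"
    have "0 < teig m p C j" using pos ij by simp
    thus "teig m p C j powr s \<le> teig m p C i powr s"
      using True monotone_onD[OF antimono_teig[OF C] ij] by (intro powr_mono2) auto
  qed
  thus ?thesis by (rule gauge_ky_fan_antimono[OF k]) simp
next
  case False
  thus ?thesis using s gauge_ky_fan_full[of "m * p" "\<lambda>i. teig m p C i powr s"] by simp
qed

section \<open>Recovery of the majorization from the power inequalities\<close>

context tpsd_family
begin

lemma nn_integral_ky_fan_powr:
  assumes k: "1 \<le> k" "k \<le> N" and s: "\<bar>s\<bar> \<le> 1" "0 < s \<or> k = N"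
  shows "AE \<tau> in \<nu>. fnorm (ky_fan k) m p (\<lambda>x. x powr s) (D \<tau>) = ennreal (\<Sum>i<k. lam \<tau> i powr s)"
    and "(\<integral>\<^sup>+ \<tau>. fnorm (ky_fan k) m p (\<lambda>x. x powr s) (D \<tau>) \<partial>\<nu>) = ennreal (\<Sum>i<k. \<integral>\<tau>. lam \<tau> i powr s \<partial>\<nu>)"
proof -
  show eq: "AE \<tau> in \<nu>. fnorm (ky_fan k) m p (\<lambda>x. x powr s) (D \<tau>) = ennreal (\<Sum>i<k. lam \<tau> i powr s)"
    using fnorm_family[OF sym_gauge_ky_fan[OF k], of "\<lambda>x. x powr s"] AE_lam_pos
  proof eventually_elim
    case (elim \<tau>)
    thus ?case using vgauge_ky_fan_powr[OF tsym _ k(2) s(2), of \<tau>] by simp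
  qed
  have int: "integrable \<nu> (\<lambda>\<tau>. lam \<tau> i powr s)" if "i < k" for i
    using that k s by (intro integrable_lam_powr) auto
  have "(\<integral>\<^sup>+ \<tau>. fnorm (ky_fan k) m p (\<lambda>x. x powr s) (D \<tau>) \<partial>\<nu>) = (\<integral>\<^sup>+ \<tau>. ennreal (\<Sum>i<k. lam \<tau> i powr s) \<partial>\<nu>)"
    using eq by (rule nn_integral_cong_AE)
  also have "\<dots> = ennreal (\<integral>\<tau>. (\<Sum>i<k. lam \<tau> i powr s) \<partial>\<nu>)"
    using int by (intro nn_integral_eq_integral) (auto intro!: sum_nonneg)
  also have "(\<integral>\<tau>. (\<Sum>i<k. lam \<tau> i powr s) \<partial>\<nu>) = (\<Sum>i<k. \<integral>\<tau>. lam \<tau> i powr s \<partial>\<nu>)"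
    using int by (intro Bochner_Integration.integral_sum) auto
  finally show "(\<integral>\<^sup>+ \<tau>. fnorm (ky_fan k) m p (\<lambda>x. x powr s) (D \<tau>) \<partial>\<nu>) = ennreal (\<Sum>i<k. \<integral>\<tau>. lam \<tau> i powr s \<partial>\<nu>)" .
qed

lemma ln_majorized_of_power_bounds:
  assumes C: "tpsd m p C" and bounds: "ky_fan_power_bounds C"
  shows "ln_majorized (teig m p C)"
proof -
  let ?x = "teig m p C"
  have Cs: "tsym m p C" using C by (simp add: tpsd_def)
  have N1: "1 \<le> N" using size_pos by simp
  have pos: "0 < ?x i" if i: "i < N" for i
  proof -
    \<comment> \<open>With exponent -1 a zero T-eigenvalue of \<open>C\<close> makes the left-hand
      norm infinite, against a finite integral on the right.\<close>
    have "fnorm (ky_fan N) m p (\<lambda>x. x powr (- 1)) C \<le> (\<integral>\<^sup>+ \<tau>. fnorm (ky_fan N) m p (\<lambda>x. x powr (- 1)) (D \<tau>) \<partial>\<nu>)"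
      by (rule bounds[unfolded ky_fan_power_bounds_def, rule_format]) (use N1 in auto)
    also have "\<dots> < \<infinity>" using nn_integral_ky_fan_powr(2)[of N "- 1"] N1 by simp
    finally have "fnorm (ky_fan N) m p (\<lambda>x. x powr (- 1)) C < \<infinity>" .
    hence "0 \<notin> set (teig_list m p C)"
      using flim0_neg_powr[of 1] unfolding fnorm_def by (auto split: if_splits)
    hence "?x i \<noteq> 0" using i unfolding set_teig_list[OF Cs] by auto
    thus ?thesis using tpsd_teig_nonneg[OF C i] by simp
  qed
  have bound: "(\<Sum>i<k. ?x i powr s) \<le> (\<Sum>i<k. \<integral>\<tau>. lam \<tau> i powr s \<partial>\<nu>)"
    if "1 \<le> k" "k \<le> N" "s \<noteq> 0" "\<bar>s\<bar> \<le> 1" "0 < s \<or> k = N" for k s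
  proof -
    have "ennreal (\<Sum>i<k. ?x i powr s) = fnorm (ky_fan k) m p (\<lambda>x. x powr s) C"
      using fnorm_eq[OF Cs pos sym_gauge_ky_fan[OF that(1,2)]] vgauge_ky_fan_powr[OF Cs pos that(2,5)] by simp
    also have "\<dots> \<le> (\<integral>\<^sup>+ \<tau>. fnorm (ky_fan k) m p (\<lambda>x. x powr s) (D \<tau>) \<partial>\<nu>)"
      using bounds that unfolding ky_fan_power_bounds_def by blast
    also have "\<dots> = ennreal (\<Sum>i<k. \<integral>\<tau>. lam \<tau> i powr s \<partial>\<nu>)"
      by (rule nn_integral_ky_fan_powr(2)) (use that in auto)
    finally show ?thesis by (simp add: sum_nonneg)
  qed
  \<comment> \<open>Both signs of the exponent at once: \<open>z powr (e / (n+1))\<close> with \<open>e = 1\<close> or \<open>e = - 1\<close>.\<close>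
  have limit: "(\<Sum>i<k. ln (?x i powr e)) \<le> (\<Sum>i<k. \<integral>\<tau>. ln (lam \<tau> i powr e) \<partial>\<nu>)"
    if k: "1 \<le> k" "k \<le> N" and e: "\<bar>e\<bar> = 1" "e = 1 \<or> k = N" for k and e :: real
  proof (rule LIMSEQ_le_const)
    let ?q = "\<lambda>n. 1 / real (Suc n)"
    have sum_quot: "(\<Sum>i<k. (y i - 1) / c) = ((\<Sum>i<k. y i) - real k) / c" for y :: "nat \<Rightarrow> real" and c
      by (simp add: sum_subtractf flip: sum_divide_distrib)
    have Z: "integrable \<nu> (\<lambda>\<tau>. lam \<tau> i powr e)" "integrable \<nu> (\<lambda>\<tau>. ln (lam \<tau> i powr e))"
      "AE \<tau> in \<nu>. 0 < lam \<tau> i powr e" if i: "i < k" for i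
    proof -
      have iN: "i < N" using i k by simp
      show "integrable \<nu> (\<lambda>\<tau>. lam \<tau> i powr e)" using integrable_lam_powr[OF iN] e by simp
      have "integrable \<nu> (\<lambda>\<tau>. e * ln (lam \<tau> i))" using integrable_ln_lam[OF iN] by simp
      moreover have "(\<lambda>\<tau>. ln (lam \<tau> i powr e)) = (\<lambda>\<tau>. e * ln (lam \<tau> i))"
        by (auto simp: powr_def)
      ultimately show "integrable \<nu> (\<lambda>\<tau>. ln (lam \<tau> i powr e))" by simp
      show "AE \<tau> in \<nu>. 0 < lam \<tau> i powr e"
        using AE_lam_pos
      proof eventually_elim
        case (elim \<tau>)
        hence "0 < lam \<tau> i" using iN by blast
        thus ?case by simp
      qed
    qed
    show "(\<lambda>n. \<Sum>i<k. \<integral>\<tau>. ((lam \<tau> i powr e) powr ?q n - 1) / ?q n \<partial>\<nu>)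
        \<longlonglongrightarrow> (\<Sum>i<k. \<integral>\<tau>. ln (lam \<tau> i powr e) \<partial>\<nu>)"
      using Z by (intro tendsto_sum integral_powr_quotient_tendsto prob_space_axioms) auto
    \<comment> \<open>The logarithm lies below every difference quotient, so the left side is free
      of n, the inequality holds for all n, and only the right side has to converge. Summed over the
      \<open>k\<close> indices, the constants 1 of the quotients give the same \<open>real k\<close>
      on both sides.\<close>
    show "\<exists>n0. \<forall>n\<ge>n0. (\<Sum>i<k. ln (?x i powr e)) \<le> (\<Sum>i<k. \<integral>\<tau>. ((lam \<tau> i powr e) powr ?q n - 1) / ?q n \<partial>\<nu>)"
    proof (intro exI allI impI)
      fix n
      let ?s = "e * ?q n"
      have q: "0 < ?q n" "?q n \<le> 1" by auto
      have s: "?s \<noteq> 0" "\<bar>?s\<bar> \<le> 1" "0 < ?s \<or> k = N" using e q by (auto simp: abs_mult)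
      have int: "integrable \<nu> (\<lambda>\<tau>. lam \<tau> i powr ?s)" if "i < k" for i
        using that k s by (intro integrable_lam_powr) auto
      have "(\<Sum>i<k. ln (?x i powr e)) \<le> (\<Sum>i<k. ((?x i powr e) powr ?q n - 1) / ?q n)"
      proof (intro sum_mono ln_le_powr_quotient q(1))
        fix i assume "i \<in> {..<k}"
        hence "0 < ?x i" using pos k by simp
        thus "0 < ?x i powr e" by simp
      qed
      also have "\<dots> = ((\<Sum>i<k. ?x i powr ?s) - real k) / ?q n"
        unfolding powr_powr by (rule sum_quot)
      also have "\<dots> \<le> ((\<Sum>i<k. \<integral>\<tau>. lam \<tau> i powr ?s \<partial>\<nu>) - real k) / ?q n"
        using bound[OF k s] q by (intro divide_right_mono diff_mono) auto
      also have "\<dots> = (\<Sum>i<k. ((\<integral>\<tau>. lam \<tau> i powr ?s \<partial>\<nu>) - 1) / ?q n)"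
        by (rule sum_quot[symmetric])
      also have "\<dots> = (\<Sum>i<k. \<integral>\<tau>. ((lam \<tau> i powr e) powr ?q n - 1) / ?q n \<partial>\<nu>)"
      proof (intro sum.cong refl)
        fix i assume "i \<in> {..<k}"
        hence "integrable \<nu> (\<lambda>\<tau>. lam \<tau> i powr ?s)" using int by simp
        thus "((\<integral>\<tau>. lam \<tau> i powr ?s \<partial>\<nu>) - 1) / ?q n = (\<integral>\<tau>. ((lam \<tau> i powr e) powr ?q n - 1) / ?q n \<partial>\<nu>)"
          unfolding powr_powr integral_divide_zero
          by (subst Bochner_Integration.integral_diff) (auto simp: prob_space)
      qed
      finally show "(\<Sum>i<k. ln (?x i powr e)) \<le> (\<Sum>i<k. \<integral>\<tau>. ((lam \<tau> i powr e) powr ?q n - 1) / ?q n \<partial>\<nu>)" .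
    qed
  qed
  have ln_powr': "ln (z powr e) = e * ln z" for z e :: real by (simp add: powr_def)
  have le: "(\<Sum>i<k. ln (?x i)) \<le> sum mean_ln {..<k}" if "k \<le> N" for k
    using limit[of k 1] that unfolding ln_powr' by (cases "k = 0") (simp_all add: mean_ln_def)
  \<comment> \<open>The exponent -1 with k = N changes the sign of every logarithm and so reverses
    the inequality.\<close>
  have "- (\<Sum>i<N. ln (?x i)) \<le> - sum mean_ln {..<N}"
    using limit[of N "- 1"] N1 unfolding ln_powr' by (simp add: mean_ln_def sum_negf)
  with le[of N] have "(\<Sum>i<N. ln (?x i)) = sum mean_ln {..<N}" by simp
  thus ?thesis using pos le unfolding ln_majorized_def by blast
qed

text \<open>The geometric mean of the norms is at most their arithmetic mean. Jensen's inequality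
  needs an integrable \<open>ln (G \<tau>)\<close>: it lies between
  \<open>s * ln (lam \<tau> 0)\<close>, the logarithm of the summand with index 0, and
  \<open>G \<tau> - 1\<close>.\<close>

lemma eexp_eint_ky_fan_powr_le:
  assumes k: "1 \<le> k" "k \<le> N" and s: "\<bar>s\<bar> \<le> 1" "0 < s \<or> k = N"
  shows "eexp (eint \<nu> (\<lambda>\<tau>. elog (fnorm (ky_fan k) m p (\<lambda>x. x powr s) (D \<tau>))))
    \<le> enn2ereal (\<integral>\<^sup>+ \<tau>. fnorm (ky_fan k) m p (\<lambda>x. x powr s) (D \<tau>) \<partial>\<nu>)"
proof -
  define G where "G \<tau> = (\<Sum>i<k. lam \<tau> i powr s)" for \<tau>
  have int: "integrable \<nu> (\<lambda>\<tau>. lam \<tau> i powr s)" if "i < k" for i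
    using that k s by (intro integrable_lam_powr) auto
  have G: "integrable \<nu> G" unfolding G_def using int by (intro Bochner_Integration.integrable_sum) auto
  have ge: "AE \<tau> in \<nu>. 0 < lam \<tau> 0 \<and> lam \<tau> 0 powr s \<le> G \<tau>"
    using AE_lam_pos
  proof eventually_elim
    case (elim \<tau>)
    have "lam \<tau> 0 powr s \<le> G \<tau>" unfolding G_def using k by (intro member_le_sum) auto
    thus ?case using elim size_pos by auto
  qed
  hence pos: "AE \<tau> in \<nu>. 0 < G \<tau>"
    by eventually_elim (metis less_le_trans powr_gt_zero less_irrefl)
  have lnG: "integrable \<nu> (\<lambda>\<tau>. ln (G \<tau>))"
  proof (rule Bochner_Integration.integrable_bound[of _ "\<lambda>\<tau>. \<bar>G \<tau>\<bar> + \<bar>s * ln (lam \<tau> 0)\<bar>"])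
    show "integrable \<nu> (\<lambda>\<tau>. \<bar>G \<tau>\<bar> + \<bar>s * ln (lam \<tau> 0)\<bar>)"
      using G integrable_ln_lam[of 0] size_pos by (intro Bochner_Integration.integrable_add integrable_abs integrable_mult_right) auto
    show "(\<lambda>\<tau>. ln (G \<tau>)) \<in> borel_measurable \<nu>" using borel_measurable_integrable[OF G] by measurable
    show "AE \<tau> in \<nu>. norm (ln (G \<tau>)) \<le> norm (\<bar>G \<tau>\<bar> + \<bar>s * ln (lam \<tau> 0)\<bar>)"
      using ge pos
    proof eventually_elim
      case (elim \<tau>)
      have "ln (lam \<tau> 0 powr s) \<le> ln (G \<tau>)" using elim by (subst ln_le_cancel_iff) auto
      hence "s * ln (lam \<tau> 0) \<le> ln (G \<tau>)" using elim by (simp add: ln_powr)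
      moreover have "ln (G \<tau>) \<le> G \<tau> - 1" using elim by (intro ln_le_minus_one) auto
      ultimately show ?case unfolding real_norm_def by linarith
    qed
  qed
  have "AE \<tau> in \<nu>. elog (fnorm (ky_fan k) m p (\<lambda>x. x powr s) (D \<tau>)) = ereal (ln (G \<tau>))"
    using nn_integral_ky_fan_powr(1)[OF k s] pos
    by eventually_elim (simp add: elog_def eln_def G_def)
  from eint_eq[OF lnG this]
  have "eexp (eint \<nu> (\<lambda>\<tau>. elog (fnorm (ky_fan k) m p (\<lambda>x. x powr s) (D \<tau>)))) = ereal (exp (\<integral>\<tau>. ln (G \<tau>) \<partial>\<nu>))"
    by (simp add: eexp_def)
  also have "\<dots> \<le> ereal (\<integral>\<tau>. G \<tau> \<partial>\<nu>)" using exp_integral_ln_le[OF G lnG pos prob_space_axioms] by simp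
  also have "(\<integral>\<tau>. G \<tau> \<partial>\<nu>) = (\<Sum>i<k. \<integral>\<tau>. lam \<tau> i powr s \<partial>\<nu>)"
    unfolding G_def using int by (intro Bochner_Integration.integral_sum) auto
  also have "ereal \<dots> = enn2ereal (\<integral>\<^sup>+ \<tau>. fnorm (ky_fan k) m p (\<lambda>x. x powr s) (D \<tau>) \<partial>\<nu>)"
    unfolding nn_integral_ky_fan_powr(2)[OF k s] by (simp add: enn2ereal_ennreal sum_nonneg)
  finally show ?thesis .
qed

end

text \<open>On the logarithmic scale a power is linear, so it is an admissible test function in (ii)
  for either sign of \<open>s\<close>, with equality in the convexity condition.\<close>

lemma eln_powr_exp: "eln (exp z powr s) = ereal (s * z)"
  by (simp add: eln_def ln_powr)

theorem mainTheorem7: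
  fixes \<nu> :: "'a::metric_space measure"
    and m p :: nat
    and C :: "nat \<Rightarrow> real mat"
    and D :: "'a \<Rightarrow> nat \<Rightarrow> real mat"
  assumes "0 < m" and "0 < p"
    and "sigma_compact_space TYPE('a)"
    and "prob_space \<nu>" and "sets \<nu> = sets borel"
    and "tpsd m p C"
    and "\<forall>\<tau>. tpsd m p (D \<tau>)"
    and "\<forall>k<p. \<forall>i<m. \<forall>j<m. continuous_on UNIV (\<lambda>\<tau>. D \<tau> k $$ (i, j))"
    and "bdd_above (range (\<lambda>\<tau>. topnorm m p (D \<tau>)))"
    and "\<forall>q::real. 0 < q \<longrightarrow>
           (\<integral>\<^sup>+ \<tau>. fnorm sum_list m p (\<lambda>x. x powr (- q)) (D \<tau>) \<partial>\<nu>) < \<infinity>"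
  shows
   "(logmaj (map ereal (teig_list m p C))
       (map (\<lambda>i. eexp (eint \<nu> (\<lambda>\<tau>. eln (teig_list m p (D \<tau>) ! i)))) [0..<m*p])
    \<longleftrightarrow>
    (\<forall>f \<rho>. continuous_on {0<..} f \<and> (\<forall>x>0. 0 \<le> f x) \<and>
        (\<forall>x y t. 0 \<le> t \<and> t \<le> 1 \<longrightarrow>
           eln (f (exp ((1 - t) * x + t * y)))
             \<le> ereal (1 - t) * eln (f (exp x)) + ereal t * eln (f (exp y))) \<and>
        sym_gauge (m*p) \<rho>
      \<longrightarrow> enn2ereal (fnorm \<rho> m p f C)
            \<le> eexp (eint \<nu> (\<lambda>\<tau>. elog (fnorm \<rho> m p f (D \<tau>))))))
   \<and>
   ((\<forall>f \<rho>. continuous_on {0<..} f \<and> (\<forall>x>0. 0 \<le> f x) \<and>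
        (\<forall>x y t. 0 \<le> t \<and> t \<le> 1 \<longrightarrow>
           eln (f (exp ((1 - t) * x + t * y)))
             \<le> ereal (1 - t) * eln (f (exp x)) + ereal t * eln (f (exp y))) \<and>
        sym_gauge (m*p) \<rho>
      \<longrightarrow> enn2ereal (fnorm \<rho> m p f C)
            \<le> eexp (eint \<nu> (\<lambda>\<tau>. elog (fnorm \<rho> m p f (D \<tau>)))))
    \<longleftrightarrow>
    (\<forall>g \<rho>. continuous_on {0<..} g \<and> (\<forall>x>0. 0 \<le> g x) \<and>
        convex_on UNIV (\<lambda>x. g (exp x)) \<and> sym_gauge (m*p) \<rho>
      \<longrightarrow> fnorm \<rho> m p g C \<le> (\<integral>\<^sup>+ \<tau>. fnorm \<rho> m p g (D \<tau>) \<partial>\<nu>)))"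
    (is "(?i \<longleftrightarrow> ?ii) \<and> (?ii \<longleftrightarrow> ?iii)")
proof -
  interpret prob_space \<nu> by fact
  interpret tpsd_family \<nu> m p D by unfold_locales (use assms in auto)
  note C = \<open>tpsd m p C\<close>
  have i_iff: "?i \<longleftrightarrow> ln_majorized (teig m p C)" by (rule logmaj_iff_ln_majorized[OF C])
  have i_ii: ?ii if ?i
    using that log_convex_bound_of_ln_majorized[OF C] unfolding i_iff by blast
  have i_iii: ?iii if ?i
    using that convex_bound_of_ln_majorized[OF C] unfolding i_iff by blast
  have cont: "continuous_on {0<..} (\<lambda>x::real. x powr s)" for s
    by (intro continuous_intros) auto
  have "ky_fan_power_bounds C" if ii: ?ii
    unfolding ky_fan_power_bounds_def
  proof (intro allI impI)
    fix s :: real and k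
    assume s: "s \<noteq> 0" "\<bar>s\<bar> \<le> 1" and k: "1 \<le> k" "k \<le> m * p" and sk: "0 < s \<or> k = m * p"
    have "enn2ereal (fnorm (ky_fan k) m p (\<lambda>x. x powr s) C)
        \<le> eexp (eint \<nu> (\<lambda>\<tau>. elog (fnorm (ky_fan k) m p (\<lambda>x. x powr s) (D \<tau>))))"
    proof (rule ii[rule_format], intro conjI allI impI)
      fix x y t :: real
      show "eln (exp ((1 - t) * x + t * y) powr s) \<le> ereal (1 - t) * eln (exp x powr s) + ereal t * eln (exp y powr s)"
        unfolding eln_powr_exp by (simp add: algebra_simps)
    qed (use cont sym_gauge_ky_fan[OF k] in auto)
    also have "\<dots> \<le> enn2ereal (\<integral>\<^sup>+ \<tau>. fnorm (ky_fan k) m p (\<lambda>x. x powr s) (D \<tau>) \<partial>\<nu>)"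
      by (rule eexp_eint_ky_fan_powr_le[OF k s(2) sk])
    finally show "fnorm (ky_fan k) m p (\<lambda>x. x powr s) C \<le> (\<integral>\<^sup>+ \<tau>. fnorm (ky_fan k) m p (\<lambda>x. x powr s) (D \<tau>) \<partial>\<nu>)"
      by (simp add: less_eq_ennreal.rep_eq)
  qed
  hence ii_i: ?i if ?ii using that ln_majorized_of_power_bounds[OF C] unfolding i_iff by blast
  have "ky_fan_power_bounds C" if iii: ?iii
    unfolding ky_fan_power_bounds_def
  proof (intro allI impI)
    fix s :: real and k
    assume k: "1 \<le> k" "k \<le> m * p"
    \<comment> \<open>The composition is \<open>exp (s * x)\<close>, convex for either sign of
      \<open>s\<close>, as (iii) requires of its test functions.\<close>
    have "convex_on UNIV (\<lambda>x. exp x powr s)"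
    proof (intro convex_onI)
      fix t x y :: real assume "0 < t" "t < 1"
      thus "exp ((1 - t) *\<^sub>R x + t *\<^sub>R y) powr s \<le> (1 - t) * exp x powr s + t * exp y powr s"
        using convex_onD[OF exp_convex, of t "s * x" "s * y"] by (simp add: exp_powr_real algebra_simps)
    qed simp
    thus "fnorm (ky_fan k) m p (\<lambda>x. x powr s) C \<le> (\<integral>\<^sup>+ \<tau>. fnorm (ky_fan k) m p (\<lambda>x. x powr s) (D \<tau>) \<partial>\<nu>)"
      using cont sym_gauge_ky_fan[OF k] by (intro iii[rule_format] conjI) auto
  qed
  hence iii_i: ?i if ?iii using that ln_majorized_of_power_bounds[OF C] unfolding i_iff by blast
  show ?thesis using i_ii i_iii ii_i iii_i by blast
qed

end
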